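(* Let $X$ be a Tychonoff space. Then: (1) $nw(X)\le nw_{cz}(X)\le 2^{nw(X)}$; (2) if $X$ is compact, then $nw_{cz}(X)=nw(X)=w(X)$; (3) if $Y$ is a Tychonoff space and $X\subset Y$ is $z$-embedded in $Y$, then $nw_{cz}(X)\le nw_{cz}(Y)$; (4) if $Y$ is a Tychonoff space and $f\colon Y\to X$ is a continuous surjection, then $nw_{cz}(X)\le nw_{cz}(Y)$; (5) if $X$ is Lindelöf, then $nw_{cz}(X)\le w(X)$; (6) if $X$ is a Lindelöf $\Sigma$-space, then $nw_{cz}(X)=nw(X)$; (7) if $nw(X)=\omega$, then $nw_{cz}(X)=\omega$; (8) if $X$ is a dense subspace of a product $\prod_{\alpha\in A}X_\alpha$ of separable metrizable spaces, each having more than one point, and the set $A$ is infinite, then $nw_{cz}(X)\le w(X)=|A|$.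
   Context: $w(X)$ is the weight: the minimal cardinality of a base of $X$, plus $\omega$. A network of $X$ is a family $\mathcal N$ of subsets of $X$ such that each open set is the union of a subfamily of $\mathcal N$; $nw(X)$ is the minimal cardinality of a network of $X$, plus $\omega$. A zero set of $X$ is a set $f^{-1}(0)$ with $f\colon X\to\mathbb R$ continuous; a cozero set is the complement of a zero set. A family $\mathcal N$ of subsets of $X$ is a $cz$-network if for every cozero set $U\subset X$ there is an at most countable $\mathcal M\subset\mathcal N$ with $\bigcup\mathcal M=U$. $nw_{cz}(X)$ is the minimal cardinality of a $cz$-network of $X$, plus $\omega$. A subspace $X\subset Y$ is $z$-embedded in $Y$ if for every zero set $Q$ of $X$ there is a zero set $F$ of $Y$ with $Q=F\cap X$. A map is perfect if it is continuous, closed, and has compact point-preimages. A Lindelöf $p$-space is a space that can be perfectly mapped onto a space with a countable base; a Lindelöf $\Sigma$-space is a continuous image of a Lindelöf $p$-space. *)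

theory Defs
  imports "HOL-Analysis.Analysis"
begin

unbundle cardinal_syntax

definition Tychonoff_space :: "'a topology \<Rightarrow> bool" where
  "Tychonoff_space X \<longleftrightarrow> t1_space X \<and> completely_regular_space X"

subsection \<open>Zero sets and cozero sets\<close>

definition zero_set_of :: "'a topology \<Rightarrow> 'a set \<Rightarrow> bool" where
  "zero_set_of X Z \<longleftrightarrow>
     (\<exists>f. continuous_map X euclideanreal f \<and> Z = {x \<in> topspace X. f x = 0})"

definition cozero_set_of :: "'a topology \<Rightarrow> 'a set \<Rightarrow> bool" where
  "cozero_set_of X U \<longleftrightarrow> (\<exists>Z. zero_set_of X Z \<and> U = topspace X - Z)"

definition z_embedded_in :: "'a topology \<Rightarrow> 'a set \<Rightarrow> bool" where
  "z_embedded_in Y S \<longleftrightarrow> S \<subseteq> topspace Y \<and>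
     (\<forall>Q. zero_set_of (subtopology Y S) Q \<longrightarrow> (\<exists>F. zero_set_of Y F \<and> Q = F \<inter> S))"

subsection \<open>Bases, networks and \<open>cz\<close>-networks\<close>

definition base_of :: "'a topology \<Rightarrow> 'a set set \<Rightarrow> bool" where
  "base_of X \<B> \<longleftrightarrow> openin X = arbitrary union_of (\<lambda>V. V \<in> \<B>)"

definition network_of :: "'a topology \<Rightarrow> 'a set set \<Rightarrow> bool" where
  "network_of X \<N> \<longleftrightarrow> \<N> \<subseteq> Pow (topspace X) \<and>
     (\<forall>U. openin X U \<longrightarrow> (\<exists>\<M>. \<M> \<subseteq> \<N> \<and> \<Union>\<M> = U))"

definition cz_network_of :: "'a topology \<Rightarrow> 'a set set \<Rightarrow> bool" where
  "cz_network_of X \<N> \<longleftrightarrow> \<N> \<subseteq> Pow (topspace X) \<and>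
     (\<forall>U. cozero_set_of X U \<longrightarrow> (\<exists>\<M>. countable \<M> \<and> \<M> \<subseteq> \<N> \<and> \<Union>\<M> = U))"

subsection \<open>Cardinal functions\<close>

text \<open>
  Cardinals are the cardinal orders of the BNF cardinal library, where \<open>natLeq\<close> is
  \<open>\<omega>\<close>. They are compared by \<open>\<le>o\<close> and \<open>=o\<close>, also across types. The term
  \<open>min_card P\<close> is the minimal cardinality of a family satisfying \<open>P\<close>; it is
  meaningful only if such a family exists.
\<close>

definition min_card :: "('b set \<Rightarrow> bool) \<Rightarrow> 'b rel" where
  "min_card P = |SOME \<A>. P \<A> \<and> (\<forall>\<B>. P \<B> \<longrightarrow> |\<A>| \<le>o |\<B>| )|"

lemma min_card_ex:
  assumes "P \<B>"
  obtains \<A> where "P \<A>" and "min_card P = |\<A>|" and "\<And>\<C>. P \<C> \<Longrightarrow> |\<A>| \<le>o |\<C>|"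
proof -
  have "\<exists>r \<in> card_of ` Collect P. \<forall>r' \<in> card_of ` Collect P. r \<le>o r'"
    using assms by (intro exists_minim_Well_order) (auto simp: card_of_Well_order)
  then have "\<exists>\<A>. P \<A> \<and> (\<forall>\<B>. P \<B> \<longrightarrow> |\<A>| \<le>o |\<B>| )"
    by auto
  from someI_ex[OF this] show thesis
    using that unfolding min_card_def by blast
qed

definition weight :: "'a topology \<Rightarrow> ('a set + nat) rel" where
  "weight X = min_card (base_of X) +c natLeq"

definition nw :: "'a topology \<Rightarrow> ('a set + nat) rel" where
  "nw X = min_card (network_of X) +c natLeq"

definition nw_cz :: "'a topology \<Rightarrow> ('a set + nat) rel" where
  "nw_cz X = min_card (cz_network_of X) +c natLeq"

lemma base_of_ex: "base_of X (Collect (openin X))"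
  unfolding base_of_def
proof (rule ext, rule iffI)
  fix U
  assume "openin X U"
  then show "(arbitrary union_of (\<lambda>V. V \<in> Collect (openin X))) U"
    by (intro union_of_inc) (auto simp: arbitrary_def)
next
  fix U
  assume "(arbitrary union_of (\<lambda>V. V \<in> Collect (openin X))) U"
  then show "openin X U"
    by (auto simp: union_of_def)
qed

lemma network_of_ex: "network_of X (Collect (openin X))"
  unfolding network_of_def
proof (intro conjI allI impI)
  show "Collect (openin X) \<subseteq> Pow (topspace X)"
    by (auto dest: openin_subset)
  fix U assume "openin X U"
  then show "\<exists>\<M>. \<M> \<subseteq> Collect (openin X) \<and> \<Union>\<M> = U"
    by (intro exI[of _ "{U}"]) auto
qed

lemma cz_network_of_ex: "cz_network_of X (Collect (cozero_set_of X))"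
  unfolding cz_network_of_def
proof (intro conjI allI impI)
  show "Collect (cozero_set_of X) \<subseteq> Pow (topspace X)"
    by (auto simp: cozero_set_of_def)
  fix U assume "cozero_set_of X U"
  then show "\<exists>\<M>. countable \<M> \<and> \<M> \<subseteq> Collect (cozero_set_of X) \<and> \<Union>\<M> = U"
    by (intro exI[of _ "{U}"]) auto
qed

subsection \<open>Lindelof \<open>p\<close>-spaces and Lindelof \<open>\<Sigma>\<close>-spaces\<close>

text \<open>
  HOL cannot quantify existentially over types, so the types of the points of the witnessing
  spaces are parameters: \<open>'m\<close> for the space with a countable base, \<open>'p\<close> for the
  Lindelof \<open>p\<close>-space. In a hypothesis with \<open>'m\<close> and \<open>'p\<close> free they are arbitrary.
  The library notion \<open>perfect_map\<close> includes surjectivity.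
\<close>

definition Lindelof_p_space :: "'m itself \<Rightarrow> 'a topology \<Rightarrow> bool" where
  "Lindelof_p_space _ P \<longleftrightarrow>
     (\<exists>(M :: 'm topology) f. second_countable M \<and> perfect_map P M f)"

definition Lindelof_Sigma_space :: "'m itself \<Rightarrow> 'p itself \<Rightarrow> 'a topology \<Rightarrow> bool" where
  "Lindelof_Sigma_space m _ X \<longleftrightarrow>
     (\<exists>(P :: 'p topology) g. Lindelof_p_space m P \<and>
        continuous_map P X g \<and> g ` topspace P = topspace X)"

end

theory Submission
  imports Defs
begin

text \<open>
  A cozero set is an increasing union of closed sets, so a family is a \<open>cz\<close>-network as soon as
  every closed \<open>Z\<close> inside an open \<open>U\<close> can be covered by countably many members inside \<open>U\<close>.

  For (2) and (6), a Lindelof \<open>\<Sigma>\<close>-space carries a countable family that is a network modulo a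
  cover by compact sets. A network yields no more than \<open>nw X\<close> open sets that separate disjoint compact
  sets, and the intersections of the members of these two families form a \<open>cz\<close>-network.

  For (8), closing off a countable set of coordinates shows that the closure of any open subset of a
  product of second countable spaces depends on countably many coordinates. So a cozero set of a dense
  subspace is a countable union of traces of open sets that depend on countably many coordinates, and
  each of these is a countable union of standard boxes. Conversely, each coordinate must occur in the
  finite support of some member of a base at a given point, so \<open>|A|\<close> is at most the weight.
\<close>

section \<open>Cardinal functions\<close>

lemma Cinfinite_min_card: "Cinfinite (min_card P +c natLeq)"
  by (simp add: Cinfinite_csum natLeq_Cinfinite)

lemma min_card_witness:
  assumes "P \<B>"
  obtains \<A> where "P \<A>" and "|\<A>| \<le>o min_card P +c natLeq"
proof (rule min_card_ex[of P, OF assms])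
  fix \<A> assume "P \<A>" "min_card P = |\<A>|"
  moreover have "|\<A>| \<le>o |\<A>| +c natLeq"
    by (rule ordLeq_csum1[OF card_of_Card_order])
  ultimately show thesis
    using that by metis
qed

lemma min_card_le:
  assumes "P \<B>" "|\<B>| \<le>o r" "Cinfinite r"
  shows "min_card P +c natLeq \<le>o r"
proof (rule min_card_ex[of P, OF assms(1)])
  fix \<A> assume \<A>: "min_card P = |\<A>|" and min: "\<And>\<C>. P \<C> \<Longrightarrow> |\<A>| \<le>o |\<C>|"
  have "|\<A>| \<le>o r"
    using min[OF assms(1)] assms(2) by (rule ordLeq_transitive)
  moreover have "natLeq \<le>o r"
    by (rule natLeq_ordLeq_cinfinite[OF assms(3)])
  ultimately show ?thesis
    unfolding \<A> using csum_cinfinite_bound[OF _ _ card_of_Card_order natLeq_Card_order assms(3)] by blast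
qed

lemma weight_le: "base_of X \<B> \<Longrightarrow> |\<B>| \<le>o r \<Longrightarrow> Cinfinite r \<Longrightarrow> weight X \<le>o r"
  unfolding weight_def by (rule min_card_le)

lemma nw_le: "network_of X \<N> \<Longrightarrow> |\<N>| \<le>o r \<Longrightarrow> Cinfinite r \<Longrightarrow> nw X \<le>o r"
  unfolding nw_def by (rule min_card_le)

lemma nw_cz_le: "cz_network_of X \<N> \<Longrightarrow> |\<N>| \<le>o r \<Longrightarrow> Cinfinite r \<Longrightarrow> nw_cz X \<le>o r"
  unfolding nw_cz_def by (rule min_card_le)

lemma weight_witness: obtains \<B> where "base_of X \<B>" "|\<B>| \<le>o weight X"
  unfolding weight_def by (rule min_card_witness[of "base_of X", OF base_of_ex])

lemma nw_witness: obtains \<N> where "network_of X \<N>" "|\<N>| \<le>o nw X"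
  unfolding nw_def by (rule min_card_witness[of "network_of X", OF network_of_ex])

lemma nw_cz_witness: obtains \<N> where "cz_network_of X \<N>" "|\<N>| \<le>o nw_cz X"
  unfolding nw_cz_def by (rule min_card_witness[of "cz_network_of X", OF cz_network_of_ex])

lemma Cinfinite_weight: "Cinfinite (weight X)"
  and Cinfinite_nw: "Cinfinite (nw X)"
  and Cinfinite_nw_cz: "Cinfinite (nw_cz X)"
  unfolding weight_def nw_def nw_cz_def by (rule Cinfinite_min_card)+

section \<open>Bounds by an infinite cardinal for images, subsets, products and finite
  subsets\<close>

lemma card_of_image_le: "|A| \<le>o r \<Longrightarrow> |f ` A| \<le>o r"
  using card_of_image ordLeq_transitive by blast

lemma card_of_subset_le: "A \<subseteq> B \<Longrightarrow> |B| \<le>o r \<Longrightarrow> |A| \<le>o r"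
  using card_of_mono1 ordLeq_transitive by blast

lemma countable_card_le_natLeq: "countable A \<longleftrightarrow> |A| \<le>o natLeq"
proof -
  have "countable A \<longleftrightarrow> |A| \<le>o |UNIV :: nat set|"
    unfolding countable_def card_of_ordLeq[symmetric] by simp
  then show ?thesis
    using card_of_nat ordLeq_ordIso_trans ordIso_symmetric by blast
qed

lemma card_of_countable_le: "countable A \<Longrightarrow> Cinfinite r \<Longrightarrow> |A| \<le>o r"
  using countable_card_le_natLeq natLeq_ordLeq_cinfinite ordLeq_transitive by blast

lemma card_of_Times_le: "|A| \<le>o r \<Longrightarrow> |B| \<le>o r \<Longrightarrow> Cinfinite r \<Longrightarrow> |A \<times> B| \<le>o r"
  using card_of_Times_ordLeq_infinite_Field unfolding cinfinite_def by blast

text \<open>Each finite subset is the set of entries of a list over \<open>A\<close>. By induction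
  the lists of a fixed length number at most \<open>r\<close>, since an infinite cardinal absorbs
  its products, and there are only countably many lengths.\<close>

lemma card_of_finite_subsets_le:
  assumes r: "Cinfinite r" and A: "|A| \<le>o r"
  shows "|{F. finite F \<and> F \<subseteq> A}| \<le>o r"
proof -
  define L where "L n = {xs \<in> lists A. length xs = n}" for n
  have L: "|L n| \<le>o r" for n
  proof (induction n)
    case 0
    have "L 0 = {[]}"
      by (auto simp: L_def)
    then show ?case
      by (simp add: card_of_countable_le r)
  next
    case (Suc n)
    have "L (Suc n) \<subseteq> (\<lambda>(x, xs). x # xs) ` (A \<times> L n)"
      by (auto simp: L_def length_Suc_conv)
    then show ?case
      by (rule card_of_subset_le[OF _ card_of_image_le[OF card_of_Times_le[OF A Suc r]]])
  qed
  have "|\<Union>n. L n| \<le>o r"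
    using r L by (intro card_of_UNION_ordLeq_infinite_Field)
      (auto simp: cinfinite_def card_of_countable_le r)
  moreover have "{F. finite F \<and> F \<subseteq> A} \<subseteq> set ` (\<Union>n. L n)"
  proof clarify
    fix F assume "finite F" "F \<subseteq> A"
    then obtain xs where "set xs = F"
      using finite_list by blast
    then have "xs \<in> L (length xs)"
      using \<open>F \<subseteq> A\<close> by (auto simp: L_def)
    then show "F \<in> set ` (\<Union>n. L n)"
      using \<open>set xs = F\<close> by blast
  qed
  ultimately show ?thesis
    by (meson card_of_image_le card_of_subset_le)
qed

section \<open>Networks and cozero sets\<close>

lemma base_of_iff:
  "base_of X \<B> \<longleftrightarrow>
    (\<forall>V\<in>\<B>. openin X V) \<and> (\<forall>U x. openin X U \<and> x \<in> U \<longrightarrow> (\<exists>V\<in>\<B>. x \<in> V \<and> V \<subseteq> U))"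
  unfolding base_of_def openin_topology_base_unique by blast

lemma base_ofE:
  assumes "base_of X \<B>" "openin X U" "x \<in> U"
  obtains V where "V \<in> \<B>" "x \<in> V" "V \<subseteq> U"
proof -
  have "\<exists>V\<in>\<B>. x \<in> V \<and> V \<subseteq> U"
    using assms unfolding base_of_iff by simp
  then show thesis
    using that by (elim bexE conjE)
qed

lemma network_of_iff:
  "network_of X \<N> \<longleftrightarrow>
    \<N> \<subseteq> Pow (topspace X) \<and> (\<forall>U x. openin X U \<and> x \<in> U \<longrightarrow> (\<exists>M\<in>\<N>. x \<in> M \<and> M \<subseteq> U))"
proof
  assume N: "network_of X \<N>"
  have "\<exists>M\<in>\<N>. x \<in> M \<and> M \<subseteq> U" if U: "openin X U" "x \<in> U" for U x
  proof -
    obtain \<M> where "\<M> \<subseteq> \<N>" "\<Union>\<M> = U"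
      using N U(1) unfolding network_of_def by blast
    then show ?thesis
      using U(2) by blast
  qed
  then show "\<N> \<subseteq> Pow (topspace X) \<and> (\<forall>U x. openin X U \<and> x \<in> U \<longrightarrow> (\<exists>M\<in>\<N>. x \<in> M \<and> M \<subseteq> U))"
    using N unfolding network_of_def by blast
next
  assume R: "\<N> \<subseteq> Pow (topspace X) \<and> (\<forall>U x. openin X U \<and> x \<in> U \<longrightarrow> (\<exists>M\<in>\<N>. x \<in> M \<and> M \<subseteq> U))"
  show "network_of X \<N>"
    unfolding network_of_def
  proof (intro conjI allI impI)
    fix U assume "openin X U"
    with R have "\<Union>{M \<in> \<N>. M \<subseteq> U} = U"
      by blast
    then show "\<exists>\<M>. \<M> \<subseteq> \<N> \<and> \<Union>\<M> = U"
      by (intro exI[of _ "{M \<in> \<N>. M \<subseteq> U}"]) simp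
  qed (use R in blast)
qed

lemma network_ofE:
  assumes "network_of X \<N>" "openin X U"
  obtains \<M> where "\<M> \<subseteq> \<N>" "\<Union>\<M> = U"
proof -
  have "\<exists>\<M>. \<M> \<subseteq> \<N> \<and> \<Union>\<M> = U"
    using assms unfolding network_of_def by simp
  then show thesis
    using that by (elim exE conjE)
qed

lemma cz_network_ofE:
  assumes "cz_network_of X \<N>" "cozero_set_of X U"
  obtains \<M> where "countable \<M>" "\<M> \<subseteq> \<N>" "\<Union>\<M> = U"
proof -
  have "\<exists>\<M>. countable \<M> \<and> \<M> \<subseteq> \<N> \<and> \<Union>\<M> = U"
    using assms unfolding cz_network_of_def by simp
  then show thesis
    using that by (elim exE conjE)
qed

lemma network_of_base: "base_of X \<B> \<Longrightarrow> network_of X \<B>"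
  unfolding base_of_iff network_of_iff by (auto dest: openin_subset)

section \<open>Cozero sets: closed exhaustions and complete regularity\<close>

lemma cozero_set_of_iff:
  "cozero_set_of X U \<longleftrightarrow>
    (\<exists>f. continuous_map X euclideanreal f \<and> U = {x \<in> topspace X. f x \<noteq> 0})"
proof -
  have "topspace X - {x \<in> topspace X. f x = 0} = {x \<in> topspace X. f x \<noteq> 0}" for f :: "'a \<Rightarrow> real"
    by blast
  then show ?thesis
    unfolding cozero_set_of_def zero_set_of_def by metis
qed

lemma openin_cozero_set: "cozero_set_of X U \<Longrightarrow> openin X U"
  unfolding cozero_set_of_iff
  using openin_continuous_map_preimage[of X euclideanreal _ "- {0}"] by fastforce

lemma cozero_set_exhaustion:
  assumes "cozero_set_of X U"
  obtains Z where "\<forall>n::nat. closedin X (Z n)" "U = (\<Union>n. Z n)"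
proof -
  obtain f where f: "continuous_map X euclideanreal f" and U: "U = {x \<in> topspace X. f x \<noteq> 0}"
    using assms unfolding cozero_set_of_iff by blast
  \<comment> \<open>The shift to \<open>Suc n\<close> matters: \<open>inverse 0 = 0\<close>, so
    \<open>n\<close> itself would give the whole space at 0.\<close>
  define Z where "Z n = {x \<in> topspace X. f x \<in> {y. inverse (Suc n) \<le> \<bar>y\<bar>}}" for n :: nat
  have "closed {y::real. c \<le> \<bar>y\<bar>}" for c
    by (intro closed_Collect_le continuous_intros)
  then have "\<forall>n. closedin X (Z n)"
    unfolding Z_def by (intro allI closedin_continuous_map_preimage[OF f]) auto
  moreover have "U = (\<Union>n. Z n)"
  proof
    show "U \<subseteq> (\<Union>n. Z n)"
    proof
      fix x assume "x \<in> U"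
      then have x: "x \<in> topspace X" "\<bar>f x\<bar> > 0"
        unfolding U by auto
      then obtain n where "inverse (real (Suc n)) < \<bar>f x\<bar>"
        using reals_Archimedean by blast
      with x show "x \<in> (\<Union>n. Z n)"
        by (auto simp: Z_def intro!: exI[of _ n] less_imp_le)
    qed
    show "(\<Union>n. Z n) \<subseteq> U"
    proof
      fix x assume "x \<in> (\<Union>n. Z n)"
      then obtain n where "x \<in> topspace X" "inverse (real (Suc n)) \<le> \<bar>f x\<bar>"
        by (auto simp: Z_def)
      moreover have "0 < inverse (real (Suc n))"
        by simp
      ultimately show "x \<in> U"
        unfolding U by fastforce
    qed
  qed
  ultimately show thesis
    by (rule that)
qed

text \<open>Compactness passes to closed subsets but not to cozero sets in general, so the countable
  covering is demanded only on the closed pieces of an exhaustion. The countably many countable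
  families that arise are then merged.\<close>

lemma cz_network_ofI:
  assumes "\<N> \<subseteq> Pow (topspace X)"
    and cover: "\<And>U Z. openin X U \<Longrightarrow> closedin X Z \<Longrightarrow> Z \<subseteq> U \<Longrightarrow>
      \<exists>\<M>. countable \<M> \<and> \<M> \<subseteq> \<N> \<and> Z \<subseteq> \<Union>\<M> \<and> \<Union>\<M> \<subseteq> U"
  shows "cz_network_of X \<N>"
  unfolding cz_network_of_def
proof (intro conjI allI impI)
  fix U assume U: "cozero_set_of X U"
  obtain Z where Z: "\<forall>n::nat. closedin X (Z n)" "U = (\<Union>n. Z n)"
    by (rule cozero_set_exhaustion[OF U])
  have M: "\<exists>\<M>. countable \<M> \<and> \<M> \<subseteq> \<N> \<and> Z n \<subseteq> \<Union>\<M> \<and> \<Union>\<M> \<subseteq> U" for n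
    by (rule cover[OF openin_cozero_set[OF U] Z(1)[rule_format]]) (use Z(2) in blast)
  from choice[OF allI[OF M]] obtain M
    where M: "\<forall>n. countable (M n) \<and> M n \<subseteq> \<N> \<and> Z n \<subseteq> \<Union>(M n) \<and> \<Union>(M n) \<subseteq> U" ..
  have "countable (\<Union>n. M n)" "(\<Union>n. M n) \<subseteq> \<N>"
    using M by auto
  moreover have "\<Union>(\<Union>n. M n) = U"
  proof
    show "\<Union>(\<Union>n. M n) \<subseteq> U"
      using M by blast
    show "U \<subseteq> \<Union>(\<Union>n. M n)"
    proof
      fix x assume "x \<in> U"
      then obtain n where "x \<in> Z n"
        using Z(2) by blast
      with M have "x \<in> \<Union>(M n)"
        by blast
      then show "x \<in> \<Union>(\<Union>n. M n)"
        by blast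
    qed
  qed
  ultimately show "\<exists>\<M>. countable \<M> \<and> \<M> \<subseteq> \<N> \<and> \<Union>\<M> = U"
    by (intro exI[of _ "\<Union>n. M n"] conjI)
qed (fact assms(1))

lemma Hausdorff_Tychonoff_space: "Tychonoff_space X \<Longrightarrow> Hausdorff_space X"
  unfolding Tychonoff_space_def
  using completely_regular_imp_regular_space regular_t1_imp_Hausdorff_space by blast

lemma cozero_set_base:
  assumes X: "completely_regular_space X" and U: "openin X U" "x \<in> U"
  obtains V where "cozero_set_of X V" "x \<in> V" "V \<subseteq> U"
proof -
  have "closedin X (topspace X - U)" "x \<in> topspace X - (topspace X - U)"
    using U openin_subset by blast+
  then obtain f :: "'a \<Rightarrow> real"
    where f: "continuous_map X (top_of_set {0..1}) f" "f x = 0" "f ` (topspace X - U) \<subseteq> {1}"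
    using X unfolding completely_regular_space_def by meson
  \<comment> \<open>The separating function is 1 off \<open>U\<close> and 0 at \<open>x\<close>.
    Subtracting 1 makes it vanish off \<open>U\<close> but not at \<open>x\<close>.\<close>
  have "continuous_map X euclideanreal (\<lambda>x. f x - 1)"
    using f(1) by (intro continuous_intros) (simp add: continuous_map_in_subtopology)
  then have "cozero_set_of X {x \<in> topspace X. f x - 1 \<noteq> 0}"
    unfolding cozero_set_of_iff by blast
  moreover have "x \<in> {x \<in> topspace X. f x - 1 \<noteq> 0}"
    using U f(2) openin_subset by auto
  moreover have "{x \<in> topspace X. f x - 1 \<noteq> 0} \<subseteq> U"
    using f(3) by auto
  ultimately show thesis
    by (rule that)
qed

text \<open>In a completely regular space every point of an open set has a cozero neighbourhood
  inside that set, and this neighbourhood is a union of members of \<open>\<N>\<close>.\<close>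

lemma network_of_cz_network:
  assumes X: "completely_regular_space X" and \<N>: "cz_network_of X \<N>"
  shows "network_of X \<N>"
  unfolding network_of_iff
proof (intro conjI allI impI)
  show "\<N> \<subseteq> Pow (topspace X)"
    using \<N> unfolding cz_network_of_def by blast
  fix U x assume "openin X U \<and> x \<in> U"
  then obtain V where V: "cozero_set_of X V" "x \<in> V" "V \<subseteq> U"
    using cozero_set_base[OF X, of U x] by blast
  obtain \<M> where "\<M> \<subseteq> \<N>" "\<Union>\<M> = V"
    by (rule cz_network_ofE[OF \<N> V(1)])
  then show "\<exists>M\<in>\<N>. x \<in> M \<and> M \<subseteq> U"
    using V by blast
qed

section \<open>Comparison of \<open>nw_cz\<close> with \<open>nw\<close> and \<open>weight\<close>,
  and its behaviour under subspaces and continuous images\<close>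

lemma nw_le_nw_cz:
  assumes "completely_regular_space X"
  shows "nw X \<le>o nw_cz X"
proof -
  obtain \<N> where \<N>: "cz_network_of X \<N>" "|\<N>| \<le>o nw_cz X"
    by (rule nw_cz_witness)
  show ?thesis
    by (rule nw_le[OF network_of_cz_network[OF assms \<N>(1)] \<N>(2) Cinfinite_nw_cz])
qed

text \<open>Closing a network under all unions makes every open set a single member, and the unions
  are indexed by the subsets of the network.\<close>

lemma nw_cz_le_exp_nw: "nw_cz X \<le>o ctwo ^c nw X"
proof -
  obtain \<N> where \<N>: "network_of X \<N>" "|\<N>| \<le>o nw X"
    by (rule nw_witness)
  have inf: "Cinfinite (ctwo ^c nw X)"
    by (rule Cinfinite_cexp[OF ordLeq_refl[OF Card_order_ctwo] Cinfinite_nw])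
  have "cz_network_of X (Union ` Pow \<N>)"
    unfolding cz_network_of_def
  proof (intro conjI allI impI)
    show "Union ` Pow \<N> \<subseteq> Pow (topspace X)"
      using \<N>(1) unfolding network_of_def by auto
    fix U assume "cozero_set_of X U"
    then obtain \<M> where "\<M> \<subseteq> \<N>" "\<Union>\<M> = U"
      by (rule network_ofE[OF \<N>(1) openin_cozero_set])
    then show "\<exists>\<M>. countable \<M> \<and> \<M> \<subseteq> Union ` Pow \<N> \<and> \<Union>\<M> = U"
      by (intro exI[of _ "{U}"]) auto
  qed
  moreover have "|Union ` Pow \<N>| \<le>o ctwo ^c nw X"
  \<comment> \<open>Monotonicity of cardinal powers in the exponent carries a side condition about
    an empty exponent, so the empty network is treated apart.\<close>
  proof (cases "\<N> = {}")
    case True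
    then show ?thesis
      by (simp add: card_of_countable_le inf)
  next
    case False
    have "|Pow \<N>| =o ctwo ^c |\<N>|"
      unfolding ctwo_def cexp_def Field_card_of by (rule card_of_Pow_Func)
    moreover have "ctwo ^c |\<N>| \<le>o ctwo ^c nw X"
      using False by (intro cexp_mono2'[OF \<N>(2) Card_order_ctwo]) (simp add: Field_card_of)
    ultimately show ?thesis
      by (intro card_of_image_le) (rule ordIso_ordLeq_trans)
  qed
  ultimately show ?thesis
    by (rule nw_cz_le[OF _ _ inf])
qed

text \<open>By z-embedding every cozero set of the subspace is the trace of a cozero set of
  \<open>Y\<close>, so the traces of the members of a \<open>cz\<close>-network of \<open>Y\<close>
  suffice.\<close>

lemma nw_cz_subtopology_le:
  assumes "z_embedded_in Y S"
  shows "nw_cz (subtopology Y S) \<le>o nw_cz Y"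
proof -
  obtain \<N> where \<N>: "cz_network_of Y \<N>" "|\<N>| \<le>o nw_cz Y"
    by (rule nw_cz_witness)
  have "cz_network_of (subtopology Y S) ((\<lambda>M. M \<inter> S) ` \<N>)"
    unfolding cz_network_of_def
  proof (intro conjI allI impI)
    show "(\<lambda>M. M \<inter> S) ` \<N> \<subseteq> Pow (topspace (subtopology Y S))"
      using \<N>(1) unfolding cz_network_of_def by auto
    fix U assume "cozero_set_of (subtopology Y S) U"
    then obtain F where F: "zero_set_of Y F" "U = topspace (subtopology Y S) - F \<inter> S"
      using assms unfolding cozero_set_of_def z_embedded_in_def by blast
    have "cozero_set_of Y (topspace Y - F)"
      using F(1) unfolding cozero_set_of_def by blast
    then obtain \<M> where "countable \<M>" "\<M> \<subseteq> \<N>" "\<Union>\<M> = topspace Y - F"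
      by (rule cz_network_ofE[OF \<N>(1)])
    then show "\<exists>\<M>. countable \<M> \<and> \<M> \<subseteq> (\<lambda>M. M \<inter> S) ` \<N> \<and> \<Union>\<M> = U"
      using F(2) by (intro exI[of _ "(\<lambda>M. M \<inter> S) ` \<M>"]) auto
  qed
  then show ?thesis
    by (rule nw_cz_le[OF _ card_of_image_le[OF \<N>(2)] Cinfinite_nw_cz])
qed

text \<open>Preimages of cozero sets are cozero. Images commute with unions, and by surjectivity the
  image of the preimage of \<open>U\<close> is \<open>U\<close> again.\<close>

lemma nw_cz_continuous_image_le:
  assumes f: "continuous_map Y X f" "f ` topspace Y = topspace X"
  shows "nw_cz X \<le>o nw_cz Y"
proof -
  obtain \<N> where \<N>: "cz_network_of Y \<N>" "|\<N>| \<le>o nw_cz Y"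
    by (rule nw_cz_witness)
  have "cz_network_of X ((`) f ` \<N>)"
    unfolding cz_network_of_def
  proof (intro conjI allI impI)
    show "(`) f ` \<N> \<subseteq> Pow (topspace X)"
      using \<N>(1) f(2) unfolding cz_network_of_def by (auto simp flip: f(2))
    fix U assume "cozero_set_of X U"
    then obtain h where h: "continuous_map X euclideanreal h" "U = {x \<in> topspace X. h x \<noteq> 0}"
      unfolding cozero_set_of_iff by blast
    have U: "cozero_set_of Y {y \<in> topspace Y. (h \<circ> f) y \<noteq> 0}"
      unfolding cozero_set_of_iff using continuous_map_compose[OF f(1) h(1)] by blast
    obtain \<M> where \<M>: "countable \<M>" "\<M> \<subseteq> \<N>" "\<Union>\<M> = {y \<in> topspace Y. (h \<circ> f) y \<noteq> 0}"
      by (rule cz_network_ofE[OF \<N>(1) U])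
    have "\<Union>((`) f ` \<M>) = f ` \<Union>\<M>"
      by blast
    also have "\<dots> = U"
      unfolding \<M>(3) h(2) f(2)[symmetric] by auto
    finally show "\<exists>\<M>. countable \<M> \<and> \<M> \<subseteq> (`) f ` \<N> \<and> \<Union>\<M> = U"
      using \<M> by (intro exI[of _ "(`) f ` \<M>"]) auto
  qed
  then show ?thesis
    by (rule nw_cz_le[OF _ card_of_image_le[OF \<N>(2)] Cinfinite_nw_cz])
qed

text \<open>A base is itself a \<open>cz\<close>-network here: a closed \<open>Z\<close> in an open
  \<open>U\<close> is covered by the base members inside \<open>U\<close>, and \<open>Z\<close>
  inherits the Lindelof property, so countably many of them are enough.\<close>

lemma nw_cz_le_weight:
  assumes "Lindelof_space X"
  shows "nw_cz X \<le>o weight X"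
proof -
  obtain \<B> where \<B>[rule_format]: "base_of X \<B>" "|\<B>| \<le>o weight X"
    by (rule weight_witness)
  have "cz_network_of X \<B>"
  proof (rule cz_network_ofI)
    show "\<B> \<subseteq> Pow (topspace X)"
      using network_of_base[OF \<B>(1)] unfolding network_of_def by blast
    fix U Z assume U: "openin X U" and Z: "closedin X Z" "Z \<subseteq> U"
    have "Z \<subseteq> \<Union>{V \<in> \<B>. V \<subseteq> U}"
    proof
      fix x assume "x \<in> Z"
      then obtain V where "V \<in> \<B>" "x \<in> V" "V \<subseteq> U"
        using U Z(2) \<B>(1) unfolding base_of_iff by blast
      then show "x \<in> \<Union>{V \<in> \<B>. V \<subseteq> U}"
        by blast
    qed
    moreover have "\<forall>V\<in>{V \<in> \<B>. V \<subseteq> U}. openin X V"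
      using \<B>(1) unfolding base_of_iff by blast
    ultimately obtain \<M> where "countable \<M>" "\<M> \<subseteq> {V \<in> \<B>. V \<subseteq> U}" "Z \<subseteq> \<Union>\<M>"
      using Lindelof_space_closedin_subtopology[OF assms Z(1)]
      unfolding Lindelof_space_subtopology_subset[OF closedin_subset[OF Z(1)]] by meson
    then show "\<exists>\<M>. countable \<M> \<and> \<M> \<subseteq> \<B> \<and> Z \<subseteq> \<Union>\<M> \<and> \<Union>\<M> \<subseteq> U"
      by (intro exI[of _ \<M>]) blast
  qed
  then show ?thesis
    by (rule nw_cz_le[OF _ \<B>(2) Cinfinite_weight])
qed

text \<open>All subfamilies of a countable network are countable, so it is already a
  \<open>cz\<close>-network.\<close>

lemma nw_cz_countable:
  assumes "nw X =o natLeq"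
  shows "nw_cz X =o natLeq"
proof -
  obtain \<N> where \<N>: "network_of X \<N>" "|\<N>| \<le>o nw X"
    by (rule nw_witness)
  have le: "|\<N>| \<le>o natLeq"
    using \<N>(2) assms by (rule ordLeq_ordIso_trans)
  have "cz_network_of X \<N>"
    unfolding cz_network_of_def
  proof (intro conjI allI impI)
    show "\<N> \<subseteq> Pow (topspace X)"
      using \<N>(1) unfolding network_of_def by blast
    fix U assume "cozero_set_of X U"
    then obtain \<M> where "\<M> \<subseteq> \<N>" "\<Union>\<M> = U"
      by (rule network_ofE[OF \<N>(1) openin_cozero_set])
    moreover have "countable \<M>"
      using \<open>\<M> \<subseteq> \<N>\<close> le countable_card_le_natLeq countable_subset by blast
    ultimately show "\<exists>\<M>. countable \<M> \<and> \<M> \<subseteq> \<N> \<and> \<Union>\<M> = U"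
      by (intro exI[of _ \<M>] conjI)
  qed
  from nw_cz_le[OF this le natLeq_Cinfinite] show ?thesis
    using natLeq_ordLeq_cinfinite[OF Cinfinite_nw_cz] ordIso_iff_ordLeq by blast
qed

section \<open>Networks modulo a compact cover\<close>

text \<open>For each pair of network members that have disjoint open neighbourhoods, one
  neighbourhood of the first member is chosen, which gives at most \<open>r\<close> sets. Disjoint
  neighbourhoods of two points contain network members at these points, and the set chosen for that
  pair separates the points.\<close>

lemma separating_family:
  assumes X: "Hausdorff_space X" and \<N>: "network_of X \<N>" "|\<N>| \<le>o r" and r: "Cinfinite r"
  obtains \<B> where "\<forall>U\<in>\<B>. openin X U" "|\<B>| \<le>o r"
    "\<forall>x\<in>topspace X. \<forall>y\<in>topspace X. x \<noteq> y \<longrightarrow>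
      (\<exists>U\<in>\<B>. \<exists>V. openin X V \<and> x \<in> U \<and> y \<in> V \<and> disjnt U V)"
proof -
  define sep where "sep S T U \<longleftrightarrow> openin X U \<and> S \<subseteq> U \<and> (\<exists>V. openin X V \<and> T \<subseteq> V \<and> disjnt U V)" for S T U
  define \<B> where "\<B> = (\<lambda>(S, T). SOME U. sep S T U) ` {(S, T) \<in> \<N> \<times> \<N>. \<exists>U. sep S T U}"
  have sep: "sep S T (SOME U. sep S T U)" if "sep S T U" for S T U
    using that by (rule someI)
  have 1: "\<forall>U\<in>\<B>. openin X U"
  proof
    fix U assume "U \<in> \<B>"
    then obtain S T U' where "sep S T U'" "U = (SOME U. sep S T U)"
      unfolding \<B>_def by blast
    then have "sep S T U"
      using sep by simp
    then show "openin X U"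
      unfolding sep_def by simp
  qed
  have "{(S, T) \<in> \<N> \<times> \<N>. \<exists>U. sep S T U} \<subseteq> \<N> \<times> \<N>"
    by blast
  then have 2: "|\<B>| \<le>o r"
    unfolding \<B>_def
    by (intro card_of_image_le) (rule card_of_subset_le[OF _ card_of_Times_le[OF \<N>(2) \<N>(2) r]])
  have 3: "\<exists>U\<in>\<B>. \<exists>V. openin X V \<and> x \<in> U \<and> y \<in> V \<and> disjnt U V"
    if xy: "x \<in> topspace X" "y \<in> topspace X" "x \<noteq> y" for x y
  proof -
    obtain U V where UV: "openin X U" "openin X V" "x \<in> U" "y \<in> V" "disjnt U V"
      using X xy unfolding Hausdorff_space_def by blast
    obtain S where S: "S \<in> \<N>" "x \<in> S" "S \<subseteq> U"
      using \<N>(1) UV unfolding network_of_iff by blast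
    obtain T where T: "T \<in> \<N>" "y \<in> T" "T \<subseteq> V"
      using \<N>(1) UV unfolding network_of_iff by blast
    have ex: "sep S T U"
      unfolding sep_def using UV S T by blast
    have "(SOME U. sep S T U) \<in> \<B>"
      unfolding \<B>_def using S T ex by (auto intro!: image_eqI[of _ _ "(S, T)"])
    then show ?thesis
      using sep[OF ex] S(2) T(2) unfolding sep_def by blast
  qed
  show thesis
    using that[of \<B>] 1 2 3 by blast
qed

text \<open>The usual compactness argument in two rounds. Finite intersections of separating sets
  part a point from a compact set, and finite unions of those part two compact sets. Neither closure
  raises the cardinality above \<open>r\<close>.\<close>

lemma compact_separating_family:
  assumes X: "Hausdorff_space X" and \<N>: "network_of X \<N>" "|\<N>| \<le>o r" and r: "Cinfinite r"
  obtains \<B> where "\<forall>U\<in>\<B>. openin X U" "|\<B>| \<le>o r"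
    "\<forall>K L. compactin X K \<longrightarrow> compactin X L \<longrightarrow> disjnt K L \<longrightarrow>
      (\<exists>U\<in>\<B>. \<exists>V. openin X V \<and> K \<subseteq> U \<and> L \<subseteq> V \<and> disjnt U V)"
proof -
  obtain \<B>0 where \<B>0[rule_format]: "\<forall>U\<in>\<B>0. openin X U" "|\<B>0| \<le>o r"
    and sep[rule_format]: "\<forall>x\<in>topspace X. \<forall>y\<in>topspace X. x \<noteq> y \<longrightarrow>
      (\<exists>U\<in>\<B>0. \<exists>V. openin X V \<and> x \<in> U \<and> y \<in> V \<and> disjnt U V)"
    by (rule separating_family[OF assms])
  \<comment> \<open>The factor \<open>topspace X\<close> is the value of the empty intersection,
    which arises when the compact set is empty.\<close>
  define \<B>1 where "\<B>1 = (\<lambda>\<F>. topspace X \<inter> \<Inter>\<F>) ` {\<F>. finite \<F> \<and> \<F> \<subseteq> \<B>0}"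
  define \<B> where "\<B> = Union ` {\<F>. finite \<F> \<and> \<F> \<subseteq> \<B>1}"
  have open1: "openin X U" if "U \<in> \<B>1" for U
    using that \<B>0(1) by (auto simp: \<B>1_def intro!: openin_Int_Inter)
  have 1: "openin X U" if "U \<in> \<B>" for U
    using that open1 by (auto simp: \<B>_def)
  have 2: "|\<B>| \<le>o r"
    unfolding \<B>_def \<B>1_def by (intro card_of_image_le card_of_finite_subsets_le r \<B>0(2))
  have point: "\<exists>U\<in>\<B>1. \<exists>V. openin X V \<and> x \<in> U \<and> L \<subseteq> V \<and> disjnt U V"
    if x: "x \<in> topspace X" and L: "compactin X L" and xL: "x \<notin> L" for x L
  proof -
    have "\<forall>y\<in>L. \<exists>U V. U \<in> \<B>0 \<and> openin X V \<and> x \<in> U \<and> y \<in> V \<and> disjnt U V"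
      using sep[OF x] compactin_subset_topspace[OF L] xL by blast
    then obtain U V where UV: "\<And>y. y \<in> L \<Longrightarrow> U y \<in> \<B>0 \<and> openin X (V y) \<and> x \<in> U y \<and> y \<in> V y \<and> disjnt (U y) (V y)"
      by metis
    have "\<forall>W\<in>V ` L. openin X W" "L \<subseteq> \<Union>(V ` L)"
      using UV by auto
    then obtain \<F> where "finite \<F>" "\<F> \<subseteq> V ` L" "L \<subseteq> \<Union>\<F>"
      using L unfolding compactin_def by meson
    then obtain Y where Y: "finite Y" "Y \<subseteq> L" "L \<subseteq> \<Union>(V ` Y)"
      by (metis finite_subset_image)
    show ?thesis
    proof (intro bexI exI conjI)
      show "topspace X \<inter> \<Inter>(U ` Y) \<in> \<B>1"
        unfolding \<B>1_def using Y UV by (intro imageI) auto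
      show "openin X (\<Union>(V ` Y))"
        using Y(2) UV by (intro openin_Union) blast
      show "x \<in> topspace X \<inter> \<Inter>(U ` Y)"
        using x Y(2) UV by blast
      show "disjnt (topspace X \<inter> \<Inter>(U ` Y)) (\<Union>(V ` Y))"
        unfolding disjnt_iff
      proof (intro allI notI, elim conjE UN_E)
        fix z y assume "z \<in> topspace X \<inter> \<Inter>(U ` Y)" "y \<in> Y" "z \<in> V y"
        then show False
          using UV[of y] Y(2) unfolding disjnt_iff by blast
      qed
    qed (rule Y(3))
  qed
  have 3: "\<exists>U\<in>\<B>. \<exists>V. openin X V \<and> K \<subseteq> U \<and> L \<subseteq> V \<and> disjnt U V"
    if K: "compactin X K" and L: "compactin X L" and KL: "disjnt K L" for K L
  proof -
    have "\<forall>x\<in>K. \<exists>U V. U \<in> \<B>1 \<and> openin X V \<and> x \<in> U \<and> L \<subseteq> V \<and> disjnt U V"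
      using point[OF _ L] compactin_subset_topspace[OF K] KL unfolding disjnt_def by blast
    then obtain U V where UV: "\<And>x. x \<in> K \<Longrightarrow> U x \<in> \<B>1 \<and> openin X (V x) \<and> x \<in> U x \<and> L \<subseteq> V x \<and> disjnt (U x) (V x)"
      by metis
    have "\<forall>W\<in>U ` K. openin X W" "K \<subseteq> \<Union>(U ` K)"
      using UV open1 by auto
    then obtain \<F> where "finite \<F>" "\<F> \<subseteq> U ` K" "K \<subseteq> \<Union>\<F>"
      using K unfolding compactin_def by meson
    then obtain Y where Y: "finite Y" "Y \<subseteq> K" "K \<subseteq> \<Union>(U ` Y)"
      by (metis finite_subset_image)
    show ?thesis
    proof (intro bexI exI conjI)
      show "\<Union>(U ` Y) \<in> \<B>"
        unfolding \<B>_def using Y UV by (intro imageI) auto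
      show "openin X (topspace X \<inter> \<Inter>(V ` Y))"
        using Y UV by (intro openin_Int_Inter) auto
      show "L \<subseteq> topspace X \<inter> \<Inter>(V ` Y)"
        using compactin_subset_topspace[OF L] Y(2) UV by blast
      show "disjnt (\<Union>(U ` Y)) (topspace X \<inter> \<Inter>(V ` Y))"
        unfolding disjnt_iff
      proof (intro allI notI, elim conjE UN_E)
        fix z y assume "z \<in> topspace X \<inter> \<Inter>(V ` Y)" "y \<in> Y" "z \<in> U y"
        then show False
          using UV[of y] Y(2) unfolding disjnt_iff by blast
      qed
    qed (rule Y(3))
  qed
  show thesis
    using that[of \<B>] 1 2 3 by blast
qed

text \<open>The family \<open>\<C>\<close> approximates neighbourhoods of whole compact sets only.
  Separation inside one compact set is left to a family \<open>\<B>\<close> of at most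
  \<open>nw X\<close> open sets, obtained from a network.\<close>

lemma nw_cz_le_nw_network_mod_compact:
  assumes X: "Hausdorff_space X" and \<C>: "countable \<C>" "\<C> \<subseteq> Pow (topspace X)"
    and cover: "\<And>x. x \<in> topspace X \<Longrightarrow>
      \<exists>K. compactin X K \<and> x \<in> K \<and> (\<forall>U. openin X U \<and> K \<subseteq> U \<longrightarrow> (\<exists>M\<in>\<C>. K \<subseteq> M \<and> M \<subseteq> U))"
  shows "nw_cz X \<le>o nw X"
proof -
  obtain \<N> where \<N>: "network_of X \<N>" "|\<N>| \<le>o nw X"
    by (rule nw_witness)
  obtain \<B> where \<B>[rule_format]: "\<forall>U\<in>\<B>. openin X U" "|\<B>| \<le>o nw X"
    and sep[rule_format]: "\<forall>K L. compactin X K \<longrightarrow> compactin X L \<longrightarrow> disjnt K L \<longrightarrow>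
      (\<exists>U\<in>\<B>. \<exists>V. openin X V \<and> K \<subseteq> U \<and> L \<subseteq> V \<and> disjnt U V)"
    by (rule compact_separating_family[OF X \<N> Cinfinite_nw])
  have "cz_network_of X ((\<lambda>(M, B). M \<inter> B) ` (\<C> \<times> \<B>))"
  proof (rule cz_network_ofI)
    show "(\<lambda>(M, B). M \<inter> B) ` (\<C> \<times> \<B>) \<subseteq> Pow (topspace X)"
      using \<C>(2) by auto
    fix U Z assume U: "openin X U" and Z: "closedin X Z" "Z \<subseteq> U"
    \<comment> \<open>The members of \<open>\<B>\<close> may be uncountably many, but whether one of them works for the compact set
      \<open>K\<close> depends only on a pair of members of the countable family \<open>\<C>\<close>.\<close>
    define good where "good M M' B \<longleftrightarrow> B \<in> \<B> \<and> M' \<inter> Z \<subseteq> B \<and> M \<inter> B \<subseteq> U" for M M' B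
    define P where "P = {(M, M') \<in> \<C> \<times> \<C>. \<exists>B. good M M' B}"
    define h where "h = (\<lambda>(M, M'). M \<inter> (SOME B. good M M' B))"
    have good: "good M M' (SOME B. good M M' B)" if "(M, M') \<in> P" for M M'
      using that unfolding P_def by (auto intro: someI)
    have "countable (h ` P)"
      unfolding P_def by (intro countable_image countable_subset[OF _ countable_SIGMA[OF \<C>(1) \<C>(1)]]) auto
    moreover have "h ` P \<subseteq> (\<lambda>(M, B). M \<inter> B) ` (\<C> \<times> \<B>)"
    proof clarify
      fix M M' assume "(M, M') \<in> P"
      then show "h (M, M') \<in> (\<lambda>(M, B). M \<inter> B) ` (\<C> \<times> \<B>)"
        using good[of M M'] unfolding P_def h_def good_def by auto
    qed
    moreover have "\<Union>(h ` P) \<subseteq> U"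
      using good unfolding h_def good_def by fast
    moreover have "Z \<subseteq> \<Union>(h ` P)"
    proof
      fix x assume "x \<in> Z"
      then obtain K where K: "compactin X K" "x \<in> K"
        and KM: "\<And>U. openin X U \<Longrightarrow> K \<subseteq> U \<Longrightarrow> \<exists>M\<in>\<C>. K \<subseteq> M \<and> M \<subseteq> U"
        using cover closedin_subset[OF Z(1)] by (meson subsetD)
      have "compactin X (K \<inter> Z)" "compactin X (K \<inter> (topspace X - U))"
        using K(1) Z(1) U by (auto intro: compact_Int_closedin)
      moreover have "disjnt (K \<inter> Z) (K \<inter> (topspace X - U))"
        using Z(2) unfolding disjnt_def by blast
      ultimately obtain B V where B: "B \<in> \<B>" "openin X V" "K \<inter> Z \<subseteq> B" "K \<inter> (topspace X - U) \<subseteq> V" "disjnt B V"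
        using sep by meson
      \<comment> \<open>A member \<open>M\<close> of \<open>\<C>\<close> inside
        \<open>U \<union> V\<close> satisfies \<open>M \<inter> B \<subseteq> U\<close>, because
        \<open>B\<close> misses \<open>V\<close>.\<close>
      have "K \<subseteq> U \<union> V"
        using B(4) compactin_subset_topspace[OF K(1)] by blast
      then obtain M where M: "M \<in> \<C>" "K \<subseteq> M" "M \<subseteq> U \<union> V"
        using KM[of "U \<union> V"] U B(2) by blast
      \<comment> \<open>The second member \<open>M'\<close> ensures that the set later chosen for
        the pair, possibly different from \<open>B\<close>, still contains
        \<open>K \<inter> Z\<close> and hence \<open>x\<close>.\<close>
      have "K \<subseteq> B \<union> (topspace X - Z)"
        using B(3) compactin_subset_topspace[OF K(1)] by blast
      then obtain M' where M': "M' \<in> \<C>" "K \<subseteq> M'" "M' \<subseteq> B \<union> (topspace X - Z)"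
        using KM[of "B \<union> (topspace X - Z)"] \<B>(1)[OF B(1)] Z(1) by blast
      have "good M M' B"
        unfolding good_def using B M M' unfolding disjnt_def by blast
      then have P: "(M, M') \<in> P"
        unfolding P_def using M M' by blast
      have "x \<in> h (M, M')"
        using good[OF P] \<open>x \<in> Z\<close> K(2) M M' unfolding good_def h_def by blast
      then show "x \<in> \<Union>(h ` P)"
        using P by blast
    qed
    ultimately show "\<exists>\<M>. countable \<M> \<and> \<M> \<subseteq> (\<lambda>(M, B). M \<inter> B) ` (\<C> \<times> \<B>) \<and> Z \<subseteq> \<Union>\<M> \<and> \<Union>\<M> \<subseteq> U"
      by (intro exI[of _ "h ` P"] conjI)
  qed
  moreover have "|(\<lambda>(M, B). M \<inter> B) ` (\<C> \<times> \<B>)| \<le>o nw X"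
    by (rule card_of_image_le[OF card_of_Times_le[OF
          card_of_countable_le[OF \<C>(1) Cinfinite_nw] \<B>(2) Cinfinite_nw]])
  ultimately show ?thesis
    by (rule nw_cz_le[OF _ _ Cinfinite_nw])
qed

text \<open>The whole space serves as the compact set \<open>K\<close> of every point, so a single
  member of \<open>\<C>\<close> is enough.\<close>

lemma nw_cz_le_nw_compact:
  assumes "Hausdorff_space X" "compact_space X"
  shows "nw_cz X \<le>o nw X"
  using assms
  by (intro nw_cz_le_nw_network_mod_compact[of X "{topspace X}"])
    (auto simp: compact_space_def dest: openin_subset)

text \<open>The compact cover consists of the \<open>g\<close>-images of the fibres of
  \<open>p\<close>, and the countable family of the \<open>g\<close>-images of the
  \<open>p\<close>-preimages of basic open sets. Since \<open>p\<close> is closed, an open set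
  around a fibre contains the preimage of a neighbourhood of the base point.\<close>

lemma nw_cz_le_nw_Lindelof_Sigma:
  fixes X :: "'a topology"
  assumes X: "Hausdorff_space X" and \<Sigma>: "Lindelof_Sigma_space TYPE('m) TYPE('p) X"
  shows "nw_cz X \<le>o nw X"
proof -
  obtain P :: "'p topology" and g where P: "Lindelof_p_space TYPE('m) P"
    and g: "continuous_map P X g" "g ` topspace P = topspace X"
    using \<Sigma> unfolding Lindelof_Sigma_space_def by blast
  obtain M :: "'m topology" and p where M: "second_countable M" and p: "perfect_map P M p"
    using P unfolding Lindelof_p_space_def by blast
  obtain \<V> where \<V>: "countable \<V>" "\<And>V. V \<in> \<V> \<Longrightarrow> openin M V"
    and base: "\<And>W y. openin M W \<and> y \<in> W \<Longrightarrow> \<exists>V\<in>\<V>. y \<in> V \<and> V \<subseteq> W"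
    using M unfolding second_countable_def by metis
  define h where "h V = g ` {z \<in> topspace P. p z \<in> V}" for V
  show ?thesis
  proof (rule nw_cz_le_nw_network_mod_compact[OF X])
    show "countable (h ` \<V>)"
      using \<V>(1) by simp
    show "h ` \<V> \<subseteq> Pow (topspace X)"
      unfolding h_def g(2)[symmetric] by auto
    fix x assume "x \<in> topspace X"
    then have "x \<in> g ` topspace P"
      using g(2) by simp
    then obtain z where z: "z \<in> topspace P" "g z = x"
      by (elim imageE) simp
    have pz: "p z \<in> topspace M"
      using p z(1) unfolding perfect_map_def by auto
    define F where "F = {w \<in> topspace P. p w = p z}"
    have "compactin P F"
      using p pz unfolding perfect_map_def proper_map_def F_def by simp
    then have "compactin X (g ` F)"
      by (rule image_compactin[OF _ g(1)])
    moreover have "x \<in> g ` F"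
      using z unfolding F_def by blast
    moreover have "\<exists>N\<in>h ` \<V>. g ` F \<subseteq> N \<and> N \<subseteq> U" if U: "openin X U" "g ` F \<subseteq> U" for U
    proof -
      have "openin P {w \<in> topspace P. g w \<in> U}"
        using g(1) U(1) by (rule openin_continuous_map_preimage)
      moreover have "F \<subseteq> {w \<in> topspace P. g w \<in> U}"
        using U(2) unfolding F_def by blast
      moreover have "closed_map P M p"
        using p unfolding perfect_map_def proper_map_def by blast
      ultimately obtain W where W: "openin M W" "p z \<in> W" "{w \<in> topspace P. p w \<in> W} \<subseteq> {w \<in> topspace P. g w \<in> U}"
        using pz unfolding closed_map_fibre_neighbourhood F_def by meson
      then obtain V where V: "V \<in> \<V>" "p z \<in> V" "V \<subseteq> W"
        using base by blast
      have "h V \<subseteq> U" "g ` F \<subseteq> h V"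
        using V W(3) unfolding h_def F_def by auto
      then show ?thesis
        using V(1) by blast
    qed
    ultimately show "\<exists>K. compactin X K \<and> x \<in> K \<and> (\<forall>U. openin X U \<and> K \<subseteq> U \<longrightarrow> (\<exists>N\<in>h ` \<V>. K \<subseteq> N \<and> N \<subseteq> U))"
      by (intro exI[of _ "g ` F"]) simp
  qed
qed

text \<open>A family that separates disjoint compact sets is a base: the complement of an open
  \<open>U\<close> is compact, and a member that separates a point of \<open>U\<close> from this
  complement lies in \<open>U\<close>.\<close>

lemma nw_eq_weight_compact:
  assumes X: "Hausdorff_space X" "compact_space X"
  shows "nw X =o weight X"
proof -
  obtain \<B>' where \<B>': "base_of X \<B>'" "|\<B>'| \<le>o weight X"
    by (rule weight_witness)
  obtain \<N> where \<N>: "network_of X \<N>" "|\<N>| \<le>o nw X"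
    by (rule nw_witness)
  obtain \<B> where \<B>[rule_format]: "\<forall>U\<in>\<B>. openin X U" "|\<B>| \<le>o nw X"
    and sep[rule_format]: "\<forall>K L. compactin X K \<longrightarrow> compactin X L \<longrightarrow> disjnt K L \<longrightarrow>
      (\<exists>U\<in>\<B>. \<exists>V. openin X V \<and> K \<subseteq> U \<and> L \<subseteq> V \<and> disjnt U V)"
    by (rule compact_separating_family[OF X(1) \<N> Cinfinite_nw])
  have "base_of X \<B>"
    unfolding base_of_iff
  proof (intro conjI ballI allI impI)
    fix U x assume U: "openin X U \<and> x \<in> U"
    have "compactin X {x}" "compactin X (topspace X - U)" "disjnt {x} (topspace X - U)"
      using U X(2) openin_subset by (auto intro: closedin_compact_space)
    then obtain B V where B: "B \<in> \<B>" "openin X V" "{x} \<subseteq> B" "topspace X - U \<subseteq> V" "disjnt B V"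
      using sep by meson
    have "B \<subseteq> topspace X"
      using \<B>(1)[OF B(1)] by (rule openin_subset)
    then have "B \<subseteq> U"
      using B(4,5) unfolding disjnt_iff by blast
    then show "\<exists>V\<in>\<B>. x \<in> V \<and> V \<subseteq> U"
      using B(3) by (intro bexI[OF _ B(1)]) simp
  qed (rule \<B>(1))
  then have "weight X \<le>o nw X"
    by (rule weight_le[OF _ \<B>(2) Cinfinite_nw])
  moreover have "nw X \<le>o weight X"
    by (rule nw_le[OF network_of_base[OF \<B>'(1)] \<B>'(2) Cinfinite_weight])
  ultimately show ?thesis
    using ordIso_iff_ordLeq by blast
qed

section \<open>Dense subspaces of products of second countable spaces\<close>

lemma (in Metric_space) separable_imp_second_countable:
  assumes "separable_space mtopology"
  shows "second_countable mtopology"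
proof -
  obtain C where C: "countable C" "C \<subseteq> M" "mtopology closure_of C = M"
    using assms unfolding separable_space_def by auto
  define \<B> where "\<B> = (\<lambda>(c, n). mball c (inverse (Suc n))) ` (C \<times> UNIV)"
  have "\<exists>V\<in>\<B>. x \<in> V \<and> V \<subseteq> U" if U: "openin mtopology U" and x: "x \<in> U" for U x
  proof -
    obtain r where r: "r > 0" "mball x r \<subseteq> U"
      using U x unfolding openin_mtopology by blast
    have xM: "x \<in> M"
      using openin_subset[OF U] x by auto
    \<comment> \<open>Half of \<open>r\<close>, since the ball around \<open>c\<close> has the same
      radius that bounds the distance from \<open>x\<close> to \<open>c\<close>.\<close>
    obtain n where n: "inverse (real (Suc n)) < r / 2"
      using reals_Archimedean[of "r / 2"] r(1) by auto
    have "x \<in> mtopology closure_of C"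
      using C(3) xM by simp
    moreover have "x \<in> mball x (inverse (Suc n))"
      using xM by simp
    ultimately obtain c where c: "c \<in> C" "c \<in> mball x (inverse (Suc n))"
      unfolding in_closure_of using openin_mball by metis
    have "mball c (inverse (Suc n)) \<subseteq> mball x r"
    proof
      fix y assume y: "y \<in> mball c (inverse (Suc n))"
      then have "d x y \<le> d x c + d c y"
        using triangle xM C(2) c(1) by auto
      then show "y \<in> mball x r"
        using y c n xM by simp
    qed
    moreover have "x \<in> mball c (inverse (Suc n))"
      using c xM by (simp add: commute)
    moreover have "mball c (inverse (Suc n)) \<in> \<B>"
      unfolding \<B>_def using c(1) by (auto intro!: image_eqI[of _ _ "(c, n)"])
    ultimately show ?thesis
      using r(2) by (intro bexI[of _ "mball c (inverse (Suc n))"]) auto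
  qed
  moreover have "countable \<B>"
    unfolding \<B>_def using C(1) by simp
  moreover have "\<forall>V\<in>\<B>. openin mtopology V"
    unfolding \<B>_def by auto
  ultimately show ?thesis
    unfolding second_countable_def by (intro exI[of _ \<B>]) simp
qed

lemma separable_metrizable_imp_second_countable:
  "separable_space X \<Longrightarrow> metrizable_space X \<Longrightarrow> second_countable X"
  unfolding metrizable_space_def by (auto dest: Metric_space.separable_imp_second_countable)

text \<open>Indexing every base by the natural numbers, with repetitions if necessary, lets boxes be
  coded by finite sets of pairs. A point of the space forces the base to be nonempty, as the
  enumeration requires.\<close>

lemma second_countable_base_sequence:
  assumes "second_countable X" "topspace X \<noteq> {}"
  obtains e :: "nat \<Rightarrow> 'a set" where "base_of X (range e)"
proof -
  obtain \<B> where \<B>: "countable \<B>" "base_of X \<B>"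
    using assms(1) unfolding second_countable_def base_of_iff by metis
  moreover obtain x where "x \<in> topspace X"
    using assms(2) by blast
  then have "\<exists>V\<in>\<B>. x \<in> V \<and> V \<subseteq> topspace X"
    using \<B>(2) openin_topspace[of X] unfolding base_of_iff by simp
  then have "\<B> \<noteq> {}"
    by auto
  ultimately have "base_of X (range (from_nat_into \<B>))"
    by simp
  then show thesis
    by (rule that)
qed

text \<open>Serves to move the weight between \<open>X\<close> and the dense subspace of the
  product, whose points have another type.\<close>

lemma weight_homeomorphic_le:
  assumes "X homeomorphic_space Y"
  shows "weight Y \<le>o weight X"
proof -
  obtain f g where fg: "homeomorphic_maps X Y f g"
    using assms unfolding homeomorphic_space_def by (elim exE)
  then have f: "homeomorphic_map X Y f"
    by (auto simp: homeomorphic_map_maps)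
  have fgy: "g y \<in> topspace X" "f (g y) = y" if "y \<in> topspace Y" for y
    using fg that unfolding homeomorphic_maps_def continuous_map_def by auto
  obtain \<B> where \<B>: "base_of X \<B>" "|\<B>| \<le>o weight X"
    by (rule weight_witness)
  have "base_of Y ((`) f ` \<B>)"
    unfolding base_of_iff
  proof (intro conjI ballI allI impI)
    fix W assume "W \<in> (`) f ` \<B>"
    then obtain V where V: "V \<in> \<B>" "W = f ` V"
      by (elim imageE)
    have "openin X V"
      using \<B>(1) V(1) unfolding base_of_iff by simp
    then show "openin Y W"
      unfolding V(2) using homeomorphic_map_openness[OF f openin_subset] by simp
  next
    fix U y assume U: "openin Y U \<and> y \<in> U"
    then have y: "y \<in> topspace Y"
      using openin_subset by auto
    have "openin X {x \<in> topspace X. f x \<in> U}"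
      using U homeomorphic_imp_continuous_map[OF f] by (intro openin_continuous_map_preimage) auto
    moreover have "g y \<in> {x \<in> topspace X. f x \<in> U}"
      using fgy[OF y] U by simp
    ultimately obtain V where V: "V \<in> \<B>" "g y \<in> V" "V \<subseteq> {x \<in> topspace X. f x \<in> U}"
      using \<B>(1) unfolding base_of_iff by meson
    have "y \<in> f ` V"
      using V(2) fgy(2)[OF y] by (metis imageI)
    moreover have "f ` V \<subseteq> U"
      using V(3) by auto
    ultimately show "\<exists>V\<in>(`) f ` \<B>. y \<in> V \<and> V \<subseteq> U"
      using V(1) by (intro bexI[of _ "f ` V"]) auto
  qed
  then show ?thesis
    by (rule weight_le[OF _ card_of_image_le[OF \<B>(2)] Cinfinite_weight])
qed

section \<open>Coded boxes in a product and sets that depend on few coordinates\<close>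

locale based_product =
  fixes Xs :: "'i \<Rightarrow> 'c topology" and A :: "'i set" and e :: "'i \<Rightarrow> nat \<Rightarrow> 'c set"
  assumes base: "\<And>\<alpha>. \<alpha> \<in> A \<Longrightarrow> base_of (Xs \<alpha>) (range (e \<alpha>))"
begin

abbreviation P :: "('i \<Rightarrow> 'c) topology" where
  "P \<equiv> product_topology Xs A"

text \<open>A pair \<open>(\<alpha>, n)\<close> encodes the condition \<open>x \<alpha> \<in> e \<alpha> n\<close>, and a finite set of pairs a standard box.\<close>

definition cyl :: "('i \<times> nat) set \<Rightarrow> ('i \<Rightarrow> 'c) set" where
  "cyl p = {x \<in> topspace P. \<forall>(\<alpha>, n)\<in>p. x \<alpha> \<in> e \<alpha> n}"

definition patterns :: "'i set \<Rightarrow> ('i \<times> nat) set set" where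
  "patterns B = {p. finite p \<and> p \<subseteq> B \<times> UNIV}"

text \<open>For a subset of the product this says that it is the full preimage of its projection to
  the coordinates in \<open>B\<close>.\<close>

definition supported :: "'i set \<Rightarrow> ('i \<Rightarrow> 'c) set \<Rightarrow> bool" where
  "supported B S \<longleftrightarrow> (\<forall>x\<in>S. \<forall>y\<in>topspace P. (\<forall>\<alpha>\<in>B. x \<alpha> = y \<alpha>) \<longrightarrow> y \<in> S)"

definition splice_on :: "'i set \<Rightarrow> ('i \<Rightarrow> 'c) \<Rightarrow> ('i \<Rightarrow> 'c) \<Rightarrow> 'i \<Rightarrow> 'c" where
  "splice_on B x y = (\<lambda>\<alpha>. if \<alpha> \<in> B then x \<alpha> else y \<alpha>)"

definition restr :: "'i set \<Rightarrow> ('i \<times> nat) set \<Rightarrow> ('i \<times> nat) set" where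
  "restr B p = {q \<in> p. fst q \<in> B}"

lemma in_cyl_iff: "x \<in> cyl p \<longleftrightarrow> x \<in> topspace P \<and> (\<forall>\<alpha> n. (\<alpha>, n) \<in> p \<longrightarrow> x \<alpha> \<in> e \<alpha> n)"
  unfolding cyl_def by auto

lemma cyl_Un: "cyl (p \<union> q) = cyl p \<inter> cyl q"
  unfolding cyl_def by auto

lemma restr_patterns: "p \<in> patterns A \<Longrightarrow> restr B p \<in> patterns B"
  unfolding restr_def patterns_def by auto

lemma patterns_mono: "B \<subseteq> A \<Longrightarrow> p \<in> patterns B \<Longrightarrow> p \<in> patterns A"
  unfolding patterns_def by auto

lemma splice_on_topspace:
  "x \<in> topspace P \<Longrightarrow> y \<in> topspace P \<Longrightarrow> splice_on B x y \<in> topspace P"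
  by (auto simp: splice_on_def PiE_iff extensional_def)

text \<open>Constraints of \<open>p\<close> at coordinates in \<open>B\<close> are met through
  \<open>x\<close>, all others through \<open>y\<close>.\<close>

lemma splice_on_in_cyl:
  assumes "x \<in> cyl (restr B p)" "y \<in> cyl p"
  shows "splice_on B x y \<in> cyl p"
  using assms splice_on_topspace[of x y B]
  unfolding in_cyl_iff restr_def by (auto simp: splice_on_def)

lemma openin_cyl:
  assumes "p \<in> patterns A"
  shows "openin P (cyl p)"
proof -
  have "finite p" "p \<subseteq> A \<times> UNIV"
    using assms unfolding patterns_def by auto
  then show ?thesis
  proof (induction p)
    case empty
    have "cyl {} = topspace P"
      unfolding cyl_def by simp
    then show ?case
      by (metis openin_topspace)
  next
    case (insert q p)
    obtain \<alpha> n where q: "q = (\<alpha>, n)" "\<alpha> \<in> A"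
      using insert.prems by auto
    have "openin (Xs \<alpha>) (e \<alpha> n)"
      using base[OF q(2)] unfolding base_of_iff by simp
    then have "openin P {x \<in> topspace P. x \<alpha> \<in> e \<alpha> n}"
      by (rule openin_continuous_map_preimage[OF continuous_map_product_projection[OF q(2)]])
    moreover have "cyl (insert q p) = {x \<in> topspace P. x \<alpha> \<in> e \<alpha> n} \<inter> cyl p"
      unfolding cyl_def q(1) by auto
    ultimately show ?case
      using insert by auto
  qed
qed

lemma cyl_nbhd:
  assumes "openin P U" "x \<in> U"
  obtains p where "p \<in> patterns A" "x \<in> cyl p" "cyl p \<subseteq> U"
proof -
  obtain W where W: "x \<in> PiE A W" "\<forall>i. openin (Xs i) (W i)" "finite {i. W i \<noteq> topspace (Xs i)}" "PiE A W \<subseteq> U"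
    using product_topology_open_contains_basis[OF assms] by (elim exE conjE)
  \<comment> \<open>\<open>W\<close> may also differ from the whole space at indices outside
    \<open>A\<close>, where it does not constrain the box.\<close>
  define F where "F = {i \<in> A. W i \<noteq> topspace (Xs i)}"
  have F: "finite F"
    by (rule finite_subset[OF _ W(3)]) (auto simp: F_def)
  have "\<exists>n. x i \<in> e i n \<and> e i n \<subseteq> W i" if "i \<in> F" for i
  proof -
    have i: "i \<in> A"
      using that by (simp add: F_def)
    then have "x i \<in> W i"
      using W(1) by auto
    then show ?thesis
      using base[OF i] W(2) unfolding base_of_iff by fastforce
  qed
  then obtain n where n: "\<And>i. i \<in> F \<Longrightarrow> x i \<in> e i (n i) \<and> e i (n i) \<subseteq> W i"
    by metis
  define p where "p = (\<lambda>i. (i, n i)) ` F"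
  have xP: "x \<in> topspace P"
    using openin_subset[OF assms(1)] assms(2) by (rule subsetD)
  have "p \<in> patterns A"
    using F unfolding p_def patterns_def F_def by auto
  moreover have "x \<in> cyl p"
    using xP n unfolding in_cyl_iff p_def by auto
  moreover have "cyl p \<subseteq> PiE A W"
  proof
    fix y assume y: "y \<in> cyl p"
    then have yP: "y \<in> topspace P"
      unfolding in_cyl_iff by simp
    have "y i \<in> W i" if i: "i \<in> A" for i
    proof (cases "i \<in> F")
      case True
      then have "y i \<in> e i (n i)"
        using y unfolding in_cyl_iff p_def by auto
      then show ?thesis
        using n[OF True] by auto
    next
      case False
      then show ?thesis
        using i yP unfolding F_def by (auto simp: PiE_iff)
    qed
    then show "y \<in> PiE A W"
      using yP by (auto simp: PiE_iff)
  qed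
  ultimately show thesis
    using that W(4) by (meson order_trans)
qed

section \<open>Reduction to countably many coordinates\<close>

lemma countable_patterns: "countable B \<Longrightarrow> countable (patterns B)"
  unfolding patterns_def by (intro countable_Collect_finite_subset countable_SIGMA) auto

text \<open>A Loewenheim-Skolem argument. Each stage adds the finitely many coordinates of a chosen
  extension for each of its countably many patterns. A finite pattern over the union of the stages
  lies over a single stage, so its extension lies over the next one.\<close>

lemma closing_off:
  fixes Q :: "('i \<times> nat) set \<Rightarrow> bool"
  obtains B where "countable B" "B \<subseteq> A"
    "\<forall>p\<in>patterns B. (\<exists>m\<in>patterns A. p \<subseteq> m \<and> Q m) \<longrightarrow> (\<exists>m\<in>patterns B. p \<subseteq> m \<and> Q m)"
proof -
  define good where "good p m \<longleftrightarrow> m \<in> patterns A \<and> p \<subseteq> m \<and> Q m" for p m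
  \<comment> \<open>The choice is meaningful only where an extension exists, hence the restriction
    on the patterns in \<open>step\<close>.\<close>
  define sel where "sel p = (SOME m. good p m)" for p
  have sel: "good p (sel p)" if "good p m" for p m
    unfolding sel_def using that by (rule someI)
  define step where "step C = C \<union> (\<Union>p\<in>{p \<in> patterns C. \<exists>m. good p m}. fst ` sel p)" for C
  define S where "S n = (step ^^ n) {}" for n
  have S_Suc: "S (Suc n) = step (S n)" for n
    by (simp add: S_def)
  have fin: "finite (fst ` sel p)" "fst ` sel p \<subseteq> A" if "good p m" for p m
    using sel[OF that] unfolding good_def patterns_def by auto
  have S: "countable (S n) \<and> S n \<subseteq> A" for n
  proof (induction n)
    case 0
    then show ?case
      by (simp add: S_def)
  next
    case (Suc n)
    have "countable {p \<in> patterns (S n). \<exists>m. good p m}"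
      using countable_patterns[of "S n"] Suc by (auto intro: countable_subset[of _ "patterns (S n)"])
    then have "countable (step (S n))"
      unfolding step_def using Suc fin
      by (intro countable_Un countable_UN) (auto intro: countable_finite)
    moreover have "step (S n) \<subseteq> A"
      unfolding step_def using Suc fin(2) by (intro Un_least UN_least) auto
    ultimately show ?case
      by (simp add: S_Suc)
  qed
  have mono: "S i \<subseteq> S j" if "i \<le> j" for i j
    using that by (rule lift_Suc_mono_le[rotated]) (auto simp: S_Suc step_def)
  define B where "B = (\<Union>n. S n)"
  have 1: "countable B" and 2: "B \<subseteq> A"
    unfolding B_def using S by auto
  have 3: "\<exists>m\<in>patterns B. p \<subseteq> m \<and> Q m" if p: "p \<in> patterns B" and m: "good p m" for p m
  proof -
    have "finite p" "p \<subseteq> B \<times> UNIV"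
      using p unfolding patterns_def by auto
    then have "\<exists>n. p \<subseteq> S n \<times> UNIV"
    proof (induction p)
      case empty
      then show ?case
        by simp
    next
      case (insert q p)
      then obtain n where n: "p \<subseteq> S n \<times> UNIV"
        by auto
      obtain k where k: "fst q \<in> S k"
        using insert.prems unfolding B_def by auto
      have "insert q p \<subseteq> S (max n k) \<times> UNIV"
        using n k mono[of n "max n k"] mono[of k "max n k"] by (cases q) auto
      then show ?case
        by (rule exI)
    qed
    then obtain n where "p \<subseteq> S n \<times> UNIV"
      by (elim exE)
    then have "p \<in> patterns (S n)"
      using \<open>finite p\<close> unfolding patterns_def by simp
    then have "fst ` sel p \<subseteq> S (Suc n)"
      unfolding S_Suc step_def using m by auto
    then have "fst ` sel p \<subseteq> B"
      unfolding B_def by auto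
    then have "sel p \<in> patterns B"
      using sel[OF m] unfolding good_def patterns_def by force
    then show ?thesis
      using sel[OF m] unfolding good_def by (intro bexI[of _ "sel p"]) auto
  qed
  show thesis
  proof (rule that[of B])
    show "\<forall>p\<in>patterns B. (\<exists>m\<in>patterns A. p \<subseteq> m \<and> Q m) \<longrightarrow> (\<exists>m\<in>patterns B. p \<subseteq> m \<and> Q m)"
      using 3 unfolding good_def by meson
  qed (fact 1 2)+
qed

lemma closure_countably_supported:
  assumes G: "openin P G"
  obtains B where "countable B" "B \<subseteq> A" "supported B (P closure_of G)"
proof -
  \<comment> \<open>A pattern may be contradictory, and its empty box would lie in \<open>G\<close>
    trivially. Nonemptiness is what supplies the point \<open>w\<close> below.\<close>
  define Q where "Q m \<longleftrightarrow> cyl m \<noteq> {} \<and> cyl m \<subseteq> G" for m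
  obtain B where B: "countable B" "B \<subseteq> A" and
    closed[rule_format]: "\<forall>p\<in>patterns B. (\<exists>m\<in>patterns A. p \<subseteq> m \<and> Q m) \<longrightarrow> (\<exists>m\<in>patterns B. p \<subseteq> m \<and> Q m)"
    by (rule closing_off)
  have "y \<in> P closure_of G"
    if x: "x \<in> P closure_of G" and y: "y \<in> topspace P" and xy: "\<forall>\<alpha>\<in>B. x \<alpha> = y \<alpha>" for x y
    unfolding in_closure_of
  proof (intro conjI allI impI)
    fix T assume "y \<in> T \<and> openin P T"
    then obtain l where l: "l \<in> patterns A" "y \<in> cyl l" "cyl l \<subseteq> T"
      using cyl_nbhd by metis
    have lB: "restr B l \<in> patterns B" "restr B l \<in> patterns A"
      using restr_patterns[OF l(1)] patterns_mono[OF B(2)] by auto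
    have "x \<in> topspace P"
      using x unfolding in_closure_of by simp
    \<comment> \<open>The part of the box around \<open>y\<close> that concerns \<open>B\<close> is
      a neighbourhood of \<open>x\<close>, so it meets \<open>G\<close>. Closing off then yields a
      nonempty box in \<open>G\<close> that refines it and constrains only coordinates in
      \<open>B\<close>.\<close>
    then have "x \<in> cyl (restr B l)"
      using l(2) xy unfolding in_cyl_iff restr_def by auto
    then obtain z where z: "z \<in> G" "z \<in> cyl (restr B l)"
      using x openin_cyl[OF lB(2)] unfolding in_closure_of by metis
    then obtain m where m: "m \<in> patterns A" "z \<in> cyl m" "cyl m \<subseteq> G"
      using cyl_nbhd[OF G] by metis
    have "restr B l \<subseteq> restr B l \<union> m \<and> Q (restr B l \<union> m)"
      unfolding Q_def cyl_Un using z m by auto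
    moreover have "restr B l \<union> m \<in> patterns A"
      using lB(2) m(1) unfolding patterns_def by auto
    ultimately have "\<exists>k\<in>patterns B. restr B l \<subseteq> k \<and> Q k"
      using closed[OF lB(1)] by (metis (no_types))
    then obtain k where k: "k \<in> patterns B" "restr B l \<subseteq> k" "Q k"
      by (elim bexE conjE)
    obtain w where w: "w \<in> cyl k"
      using k(3) unfolding Q_def by auto
    \<comment> \<open>Since \<open>k\<close> constrains coordinates in \<open>B\<close> only,
      \<open>w\<close> may be replaced by \<open>y\<close> elsewhere without leaving
      \<open>G\<close>. This also brings the point into the box of \<open>l\<close>.\<close>
    have "splice_on B w y \<in> cyl k"
      using w k(1) y splice_on_topspace[of w y B] unfolding in_cyl_iff patterns_def
      by (auto simp: splice_on_def)
    then have "splice_on B w y \<in> G"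
      using k(3) unfolding Q_def by auto
    moreover have "splice_on B w y \<in> cyl l"
      using w k(2) l(2) by (intro splice_on_in_cyl) (auto simp: in_cyl_iff)
    ultimately show "\<exists>u. u \<in> G \<and> u \<in> T"
      using l(3) by auto
  qed (rule y)
  then have "supported B (P closure_of G)"
    unfolding supported_def by simp
  with B show thesis
    by (rule that)
qed

lemma supported_open_covered:
  assumes W: "openin P W" "supported B W" and x: "x \<in> W"
  obtains p where "p \<in> patterns B" "x \<in> cyl p" "cyl p \<subseteq> W"
proof -
  obtain l where l: "l \<in> patterns A" "x \<in> cyl l" "cyl l \<subseteq> W"
    using cyl_nbhd W(1) x by metis
  have "cyl (restr B l) \<subseteq> W"
  proof
    fix z assume z: "z \<in> cyl (restr B l)"
    then have "splice_on B z x \<in> W"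
      using splice_on_in_cyl[OF z l(2)] l(3) by auto
    moreover have "z \<in> topspace P" "\<forall>\<alpha>\<in>B. splice_on B z x \<alpha> = z \<alpha>"
      using z unfolding in_cyl_iff splice_on_def by auto
    ultimately show "z \<in> W"
      using W(2) unfolding supported_def by blast
  qed
  moreover have "x \<in> cyl (restr B l)"
    using l(2) unfolding in_cyl_iff restr_def by auto
  ultimately show thesis
    by (intro that[OF restr_patterns[OF l(1)]])
qed

section \<open>Bases, cozero sets and weight of a dense subspace\<close>

context
  fixes D
  assumes D: "D \<subseteq> topspace P" "P closure_of D = topspace P"
begin

lemma dense_meets:
  assumes "openin P W" "x \<in> W"
  obtains d where "d \<in> D" "d \<in> W"
proof -
  have "x \<in> P closure_of D"
    unfolding D(2) using openin_subset[OF assms(1)] assms(2) by (rule subsetD)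
  then show thesis
    using that assms unfolding in_closure_of by auto
qed

lemma cyl_base: "base_of (subtopology P D) ((\<lambda>p. cyl p \<inter> D) ` patterns A)"
  unfolding base_of_iff
proof (intro conjI ballI allI impI)
  fix V assume "V \<in> (\<lambda>p. cyl p \<inter> D) ` patterns A"
  then obtain p where "p \<in> patterns A" "V = cyl p \<inter> D"
    by (elim imageE)
  then show "openin (subtopology P D) V"
    using openin_cyl unfolding openin_subtopology by auto
next
  fix U x assume U: "openin (subtopology P D) U \<and> x \<in> U"
  then obtain W where W: "openin P W" "U = W \<inter> D"
    unfolding openin_subtopology by auto
  obtain p where p: "p \<in> patterns A" "x \<in> cyl p" "cyl p \<subseteq> W"
    by (rule cyl_nbhd[OF W(1), of x]) (use U W(2) in auto)
  show "\<exists>V\<in>(\<lambda>p. cyl p \<inter> D) ` patterns A. x \<in> V \<and> V \<subseteq> U"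
    using p U W(2) by (intro bexI[of _ "cyl p \<inter> D"]) auto
qed

text \<open>The set where \<open>f\<close> is small is the trace of an open \<open>G n\<close>,
  whose closure depends on countably many coordinates. The complements of these closures form
  \<open>W\<close>, and their traces exhaust the cozero set.\<close>

lemma cozero_set_countable_support:
  assumes "cozero_set_of (subtopology P D) U"
  obtains W B where "\<forall>n::nat. openin P (W n) \<and> countable (B n) \<and> B n \<subseteq> A \<and> supported (B n) (W n)"
    "U = (\<Union>n. W n) \<inter> D"
proof -
  obtain f where f: "continuous_map (subtopology P D) euclideanreal f"
    and U: "U = {x \<in> topspace (subtopology P D). f x \<noteq> 0}"
    using assms unfolding cozero_set_of_iff by auto
  have tD: "topspace (subtopology P D) = D"
    using D(1) by auto
  have pre: "\<exists>G. openin P G \<and> {x \<in> D. f x \<in> S} = G \<inter> D" if "open S" for S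
    using openin_continuous_map_preimage[OF f, of S] that unfolding tD openin_subtopology by auto
  have "open {t::real. \<bar>t\<bar> < c}" for c
    by (intro open_Collect_less continuous_intros)
  then have "\<forall>n::nat. \<exists>G. openin P G \<and> {x \<in> D. \<bar>f x\<bar> < inverse (Suc n)} = G \<inter> D"
    using pre[of "{t. \<bar>t\<bar> < inverse (Suc n)}" for n] by simp
  then obtain G where G: "\<forall>n::nat. openin P (G n) \<and> {x \<in> D. \<bar>f x\<bar> < inverse (Suc n)} = G n \<inter> D"
    by (rule choice[THEN exE])
  have "\<exists>B. countable B \<and> B \<subseteq> A \<and> supported B (P closure_of G n)" for n
    using closure_countably_supported[of "G n"] G by metis
  from choice[OF allI[OF this]] obtain B
    where B: "\<forall>n. countable (B n) \<and> B n \<subseteq> A \<and> supported (B n) (P closure_of G n)" ..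
  define W where "W n = topspace P - P closure_of G n" for n
  \<comment> \<open>A set and its complement in the product depend on the same coordinates.\<close>
  have "supported (B n) (W n)" for n
    unfolding supported_def
  proof (intro ballI impI)
    fix x y assume x: "x \<in> W n" and y: "y \<in> topspace P" and xy: "\<forall>\<alpha>\<in>B n. x \<alpha> = y \<alpha>"
    have "y \<notin> P closure_of G n"
    proof
      assume "y \<in> P closure_of G n"
      then have "x \<in> P closure_of G n"
        using B x xy unfolding supported_def W_def by auto
      then show False
        using x unfolding W_def by simp
    qed
    then show "y \<in> W n"
      using y unfolding W_def by simp
  qed
  moreover have "openin P (W n)" for n
    unfolding W_def by (intro openin_diff openin_topspace closedin_closure_of)
  ultimately have "\<forall>n. openin P (W n) \<and> countable (B n) \<and> B n \<subseteq> A \<and> supported (B n) (W n)"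
    using B by simp
  moreover have "U = (\<Union>n. W n) \<inter> D"
  proof
    show "U \<subseteq> (\<Union>n. W n) \<inter> D"
    proof
      fix x assume "x \<in> U"
      then have x: "x \<in> D" "\<bar>f x\<bar> > 0"
        unfolding U tD by auto
      then obtain n where n: "inverse (real (Suc n)) < \<bar>f x\<bar>"
        using reals_Archimedean by blast
      have "open {t::real. inverse (real (Suc n)) < \<bar>t\<bar>}"
        by (intro open_Collect_less continuous_intros)
      then obtain H where H: "openin P H" "{x \<in> D. inverse (real (Suc n)) < \<bar>f x\<bar>} = H \<inter> D"
        using pre[of "{t. inverse (real (Suc n)) < \<bar>t\<bar>}"] by auto
      have "x \<notin> P closure_of G n"
      proof
        assume "x \<in> P closure_of G n"
        moreover have "x \<in> H"
          using H(2) x(1) n by auto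
        ultimately obtain y where y: "y \<in> G n \<inter> H"
          using H(1) unfolding in_closure_of by auto
        \<comment> \<open>Density enters here: the traces of \<open>G n\<close> and \<open>H\<close>
          on \<open>D\<close> are disjoint, while a nonempty open set would meet
          \<open>D\<close>.\<close>
        have "openin P (G n \<inter> H)"
          using G H(1) by auto
        then obtain d where d: "d \<in> D" "d \<in> G n \<inter> H"
          using y by (rule dense_meets)
        have "d \<in> {x \<in> D. \<bar>f x\<bar> < inverse (Suc n)}" "d \<in> {x \<in> D. inverse (real (Suc n)) < \<bar>f x\<bar>}"
          unfolding H(2) using G d by auto
        then show False
          by simp
      qed
      then show "x \<in> (\<Union>n. W n) \<inter> D"
        using x(1) D(1) unfolding W_def by auto
    qed
    show "(\<Union>n. W n) \<inter> D \<subseteq> U"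
    proof
      fix x assume "x \<in> (\<Union>n. W n) \<inter> D"
      then obtain n where x: "x \<in> W n" "x \<in> D"
        by auto
      have "G n \<subseteq> P closure_of G n"
        using G by (intro closure_of_subset openin_subset) simp
      then have "x \<notin> G n \<inter> D"
        using x unfolding W_def by auto
      then have "x \<notin> {x \<in> D. \<bar>f x\<bar> < inverse (Suc n)}"
        using G by simp
      then have "\<not> \<bar>f x\<bar> < inverse (real (Suc n))"
        using x(2) by simp
      moreover have "0 < inverse (real (Suc n))"
        by simp
      ultimately show "x \<in> U"
        unfolding U tD using x(2) by fastforce
    qed
  qed
  ultimately show thesis
    by (rule that)
qed

lemma cyl_cz_network: "cz_network_of (subtopology P D) ((\<lambda>p. cyl p \<inter> D) ` patterns A)"
  unfolding cz_network_of_def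
proof (intro conjI allI impI)
  show "(\<lambda>p. cyl p \<inter> D) ` patterns A \<subseteq> Pow (topspace (subtopology P D))"
    using D(1) by auto
  fix U assume "cozero_set_of (subtopology P D) U"
  then obtain W B where
    W: "\<forall>n::nat. openin P (W n) \<and> countable (B n) \<and> B n \<subseteq> A \<and> supported (B n) (W n)"
    and U: "U = (\<Union>n. W n) \<inter> D"
    by (rule cozero_set_countable_support)
  define K where "K n = {p \<in> patterns (B n). cyl p \<subseteq> W n}" for n
  have "countable (K n)" for n
    using countable_patterns[of "B n"] W unfolding K_def by (auto intro: countable_subset[of _ "patterns (B n)"])
  then have "countable ((\<lambda>p. cyl p \<inter> D) ` (\<Union>n. K n))"
    by auto
  moreover have "(\<Union>n. K n) \<subseteq> patterns A"
  proof (intro UN_least)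
    fix n
    have "B n \<subseteq> A"
      using W by simp
    then show "K n \<subseteq> patterns A"
      using patterns_mono unfolding K_def by auto
  qed
  then have "(\<lambda>p. cyl p \<inter> D) ` (\<Union>n. K n) \<subseteq> (\<lambda>p. cyl p \<inter> D) ` patterns A"
    by (rule image_mono)
  moreover have "\<Union>((\<lambda>p. cyl p \<inter> D) ` (\<Union>n. K n)) = U"
  proof
    show "\<Union>((\<lambda>p. cyl p \<inter> D) ` (\<Union>n. K n)) \<subseteq> U"
      unfolding U K_def by auto
    show "U \<subseteq> \<Union>((\<lambda>p. cyl p \<inter> D) ` (\<Union>n. K n))"
    proof
      fix x assume "x \<in> U"
      then obtain n where x: "x \<in> W n" "x \<in> D"
        unfolding U by auto
      obtain p where "p \<in> patterns (B n)" "x \<in> cyl p" "cyl p \<subseteq> W n"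
        by (rule supported_open_covered[of "W n" "B n" x]) (use W x in auto)
      then have "p \<in> K n" "x \<in> cyl p \<inter> D"
        using x(2) unfolding K_def by auto
      then show "x \<in> \<Union>((\<lambda>p. cyl p \<inter> D) ` (\<Union>n. K n))"
        by auto
    qed
  qed
  ultimately show "\<exists>\<M>. countable \<M> \<and> \<M> \<subseteq> (\<lambda>p. cyl p \<inter> D) ` patterns A \<and> \<Union>\<M> = U"
    by (intro exI[of _ "(\<lambda>p. cyl p \<inter> D) ` (\<Union>n. K n)"] conjI)
qed

text \<open>At a fixed point \<open>d\<close>, each base member that contains \<open>d\<close> gets
  the finite set of coordinates of one box around \<open>d\<close>. Every index in \<open>A\<close>
  occurs in such a set, so \<open>A\<close> is covered by at most weight many finite sets.\<close>

lemma card_of_index_le_weight: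
  assumes X: "\<And>\<alpha>. \<alpha> \<in> A \<Longrightarrow> Hausdorff_space (Xs \<alpha>) \<and> (\<exists>x\<in>topspace (Xs \<alpha>). \<exists>y\<in>topspace (Xs \<alpha>). x \<noteq> y)"
  shows "|A| \<le>o weight (subtopology P D)"
proof -
  obtain \<B> where \<B>: "base_of (subtopology P D) \<B>" "|\<B>| \<le>o weight (subtopology P D)"
    by (rule weight_witness)
  have "topspace (Xs \<alpha>) \<noteq> {}" if "\<alpha> \<in> A" for \<alpha>
    using X[OF that] by auto
  then have "topspace P \<noteq> {}"
    by (simp add: PiE_eq_empty_iff)
  then obtain d where d: "d \<in> D"
    using dense_meets[OF openin_topspace] by blast
  have dP: "d \<in> topspace P"
    using d D(1) by auto
  have "\<exists>p. p \<in> patterns A \<and> d \<in> cyl p \<and> (\<exists>G. openin P G \<and> V = G \<inter> D \<and> cyl p \<subseteq> G)"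
    if V: "V \<in> \<B>" "d \<in> V" for V
  proof -
    have "openin (subtopology P D) V"
      using \<B>(1) V(1) unfolding base_of_iff by simp
    then obtain G where G: "openin P G" "V = G \<inter> D"
      unfolding openin_subtopology by auto
    obtain p where "p \<in> patterns A" "d \<in> cyl p" "cyl p \<subseteq> G"
      by (rule cyl_nbhd[OF G(1), of d]) (use V(2) G(2) in auto)
    with G show ?thesis
      by (intro exI[of _ p] exI[of _ G] conjI)
  qed
  then obtain p where p: "\<And>V. V \<in> \<B> \<Longrightarrow> d \<in> V \<Longrightarrow>
      p V \<in> patterns A \<and> d \<in> cyl (p V) \<and> (\<exists>G. openin P G \<and> V = G \<inter> D \<and> cyl (p V) \<subseteq> G)"
    by metis
  have "A \<subseteq> (\<Union>V\<in>{V \<in> \<B>. d \<in> V}. fst ` p V)"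
  proof
    fix \<alpha> assume \<alpha>: "\<alpha> \<in> A"
    have "d \<alpha> \<in> topspace (Xs \<alpha>)"
      using dP \<alpha> by auto
    moreover obtain y where y: "y \<in> topspace (Xs \<alpha>)" "y \<noteq> d \<alpha>"
      using X[OF \<alpha>] by metis
    ultimately obtain S T where ST: "openin (Xs \<alpha>) S" "openin (Xs \<alpha>) T" "d \<alpha> \<in> S" "y \<in> T" "disjnt S T"
      using X[OF \<alpha>] unfolding Hausdorff_space_def by metis
    have openP: "openin P {x \<in> topspace P. x \<alpha> \<in> Z}" if "openin (Xs \<alpha>) Z" for Z
      using that by (rule openin_continuous_map_preimage[OF continuous_map_product_projection[OF \<alpha>]])
    have S: "openin (subtopology P D) ({x \<in> topspace P. x \<alpha> \<in> S} \<inter> D)"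
      using openP[OF ST(1)] by (rule openin_subtopology_Int)
    have "d \<in> {x \<in> topspace P. x \<alpha> \<in> S} \<inter> D"
      using dP d ST(3) by simp
    then obtain V where V: "V \<in> \<B>" "d \<in> V" "V \<subseteq> {x \<in> topspace P. x \<alpha> \<in> S} \<inter> D"
      by (rule base_ofE[OF \<B>(1) S])
    obtain G where G: "openin P G" "V = G \<inter> D" "cyl (p V) \<subseteq> G"
      using p[OF V(1,2)] by (elim exE conjE)
    have "\<alpha> \<in> fst ` p V"
    proof (rule ccontr)
      assume *: "\<alpha> \<notin> fst ` p V"
      \<comment> \<open>If \<open>\<alpha>\<close> is unconstrained, \<open>d\<close> can be moved
        to \<open>y\<close> in that coordinate within the box. The moved point may miss
        \<open>D\<close>, so density replaces it by a point \<open>w\<close> of \<open>V\<close>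
        with \<open>w \<alpha> \<in> T\<close>, although \<open>V\<close> only allows values in
        \<open>S\<close>.\<close>
      have zP: "d(\<alpha> := y) \<in> topspace P"
        using dP y(1) \<alpha> by (auto simp: PiE_iff extensional_def)
      then have "d(\<alpha> := y) \<in> cyl (p V)"
        using p[OF V(1,2)] * unfolding in_cyl_iff by (auto simp: rev_image_eqI)
      then have z: "d(\<alpha> := y) \<in> G \<inter> {x \<in> topspace P. x \<alpha> \<in> T}"
        using G(3) zP ST(4) by auto
      have "openin P (G \<inter> {x \<in> topspace P. x \<alpha> \<in> T})"
        using G(1) openP[OF ST(2)] by (rule openin_Int)
      then obtain w where w: "w \<in> D" "w \<in> G \<inter> {x \<in> topspace P. x \<alpha> \<in> T}"
        using z by (rule dense_meets)
      then have "w \<in> V"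
        using G(2) by simp
      then show False
        using V(3) w(2) ST(5) unfolding disjnt_iff by auto
    qed
    then show "\<alpha> \<in> (\<Union>V\<in>{V \<in> \<B>. d \<in> V}. fst ` p V)"
      using V by auto
  qed
  moreover have "|\<Union>V\<in>{V \<in> \<B>. d \<in> V}. fst ` p V| \<le>o weight (subtopology P D)"
  proof (rule card_of_UNION_ordLeq_infinite_Field)
    show "infinite (Field (weight (subtopology P D)))" "Card_order (weight (subtopology P D))"
      using Cinfinite_weight[of "subtopology P D"] unfolding cinfinite_def by auto
    show "|{V \<in> \<B>. d \<in> V}| \<le>o weight (subtopology P D)"
      by (rule card_of_subset_le[OF _ \<B>(2)]) auto
    show "\<forall>V\<in>{V \<in> \<B>. d \<in> V}. |fst ` p V| \<le>o weight (subtopology P D)"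
    proof
      fix V assume "V \<in> {V \<in> \<B>. d \<in> V}"
      then have "finite (fst ` p V)"
        using p unfolding patterns_def by auto
      then show "|fst ` p V| \<le>o weight (subtopology P D)"
        by (intro card_of_countable_le Cinfinite_weight countable_finite)
    qed
  qed
  ultimately show ?thesis
    by (rule card_of_subset_le)
qed

lemma card_of_cyls_le:
  assumes "infinite A"
  shows "|(\<lambda>p. cyl p \<inter> D) ` patterns A| \<le>o |A|"
proof (rule card_of_image_le)
  have A: "Cinfinite |A|"
    using assms by (simp add: cinfinite_def Field_card_of card_of_card_order_on)
  have "|A \<times> (UNIV :: nat set)| \<le>o |A|"
    by (intro card_of_Times_le A card_of_countable_le ordLeq_refl card_of_Card_order) simp
  then show "|patterns A| \<le>o |A|"
    unfolding patterns_def by (rule card_of_finite_subsets_le[OF A])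
qed

end

end

lemma dense_in_product:
  fixes X :: "'a topology" and Xs :: "'i \<Rightarrow> 'c topology"
  assumes A: "infinite A"
    and Xs: "\<And>\<alpha>. \<alpha> \<in> A \<Longrightarrow> separable_space (Xs \<alpha>) \<and> metrizable_space (Xs \<alpha>) \<and>
          (\<exists>x\<in>topspace (Xs \<alpha>). \<exists>y\<in>topspace (Xs \<alpha>). x \<noteq> y)"
    and D: "D \<subseteq> topspace (product_topology Xs A)"
      "product_topology Xs A closure_of D = topspace (product_topology Xs A)"
    and X: "X homeomorphic_space subtopology (product_topology Xs A) D"
  shows "nw_cz X \<le>o weight X \<and> weight X =o |A|"
proof -
  let ?S = "subtopology (product_topology Xs A) D"
  have "\<exists>e :: nat \<Rightarrow> 'c set. base_of (Xs \<alpha>) (range e)" if "\<alpha> \<in> A" for \<alpha>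
  proof (rule second_countable_base_sequence)
    show "second_countable (Xs \<alpha>)"
      using Xs[OF that] by (simp add: separable_metrizable_imp_second_countable)
    show "topspace (Xs \<alpha>) \<noteq> {}"
      using Xs[OF that] by auto
  qed (rule exI)
  then obtain e :: "'i \<Rightarrow> nat \<Rightarrow> 'c set" where "\<And>\<alpha>. \<alpha> \<in> A \<Longrightarrow> base_of (Xs \<alpha>) (range (e \<alpha>))"
    by metis
  then interpret based_product Xs A e
    by unfold_locales
  have inf: "Cinfinite |A|"
    using A by (simp add: cinfinite_def Field_card_of card_of_card_order_on)
  have cz: "nw_cz ?S \<le>o |A|"
    by (rule nw_cz_le[OF cyl_cz_network[OF D] card_of_cyls_le[OF D A] inf])
  have "weight ?S \<le>o |A|"
    by (rule weight_le[OF cyl_base[OF D] card_of_cyls_le[OF D A] inf])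
  then have 1: "weight X \<le>o |A|"
    using X homeomorphic_space_sym weight_homeomorphic_le ordLeq_transitive by metis
  have "|A| \<le>o weight ?S"
    using Xs by (intro card_of_index_le_weight[OF D]) (auto simp: metrizable_imp_Hausdorff_space)
  then have 2: "|A| \<le>o weight X"
    by (rule ordLeq_transitive[OF _ weight_homeomorphic_le[OF X]])
  \<comment> \<open>The inequality for continuous images also carries \<open>nw_cz\<close> across
    the homeomorphism.\<close>
  obtain f g where "homeomorphic_maps ?S X f g"
    using X homeomorphic_space_sym unfolding homeomorphic_space_def by metis
  then have "continuous_map ?S X f" "f ` topspace ?S = topspace X"
    using homeomorphic_map_maps homeomorphic_imp_continuous_map homeomorphic_imp_surjective_map by metis+
  then have "nw_cz X \<le>o nw_cz ?S"
    by (rule nw_cz_continuous_image_le)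
  then have "nw_cz X \<le>o weight X"
    using cz 2 ordLeq_transitive by metis
  with 1 2 show ?thesis
    by (simp add: ordIso_iff_ordLeq)
qed

theorem mainTheorem4:
  fixes X :: "'a topology"
  assumes "Tychonoff_space X"
  shows "(nw X \<le>o nw_cz X \<and> nw_cz X \<le>o ctwo ^c nw X) \<and>
    (compact_space X \<longrightarrow> nw_cz X =o nw X \<and> nw X =o weight X) \<and>
    (\<forall>(Y :: 'a topology) S.
       Tychonoff_space Y \<and> S \<subseteq> topspace Y \<and> X = subtopology Y S \<and> z_embedded_in Y S
       \<longrightarrow> nw_cz X \<le>o nw_cz Y) \<and>
    (\<forall>(Y :: 'b topology) f.
       Tychonoff_space Y \<and> continuous_map Y X f \<and> f ` topspace Y = topspace X
       \<longrightarrow> nw_cz X \<le>o nw_cz Y) \<and>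
    (Lindelof_space X \<longrightarrow> nw_cz X \<le>o weight X) \<and>
    (Lindelof_Sigma_space TYPE('m) TYPE('p) X \<longrightarrow> nw_cz X =o nw X) \<and>
    (nw X =o natLeq \<longrightarrow> nw_cz X =o natLeq) \<and>
    (\<forall>(A :: 'i set) (Xs :: 'i \<Rightarrow> 'c topology) D.
       infinite A \<and>
       (\<forall>\<alpha>\<in>A. separable_space (Xs \<alpha>) \<and> metrizable_space (Xs \<alpha>) \<and>
          (\<exists>x\<in>topspace (Xs \<alpha>). \<exists>y\<in>topspace (Xs \<alpha>). x \<noteq> y)) \<and>
       D \<subseteq> topspace (product_topology Xs A) \<and>
       product_topology Xs A closure_of D = topspace (product_topology Xs A) \<and>
       X homeomorphic_space subtopology (product_topology Xs A) D
       \<longrightarrow> nw_cz X \<le>o weight X \<and> weight X =o |A| )"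
proof -
  have H: "Hausdorff_space X"
    using assms by (rule Hausdorff_Tychonoff_space)
  have le: "nw X \<le>o nw_cz X"
    using assms unfolding Tychonoff_space_def by (intro nw_le_nw_cz) simp
  show ?thesis
  proof (intro conjI allI impI; (elim conjE)?)
    show "nw X \<le>o nw_cz X"
      by (rule le)
    show "nw_cz X \<le>o ctwo ^c nw X"
      by (rule nw_cz_le_exp_nw)
    show "nw_cz X =o nw X" if "compact_space X"
      using le nw_cz_le_nw_compact[OF H that] by (simp add: ordIso_iff_ordLeq)
    show "nw X =o weight X" if "compact_space X"
      using H that by (rule nw_eq_weight_compact)
    show "nw_cz X \<le>o nw_cz Y" if "X = subtopology Y S" "z_embedded_in Y S" for Y :: "'a topology" and S
      unfolding that(1) using that(2) by (rule nw_cz_subtopology_le)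
    show "nw_cz X \<le>o nw_cz Y" if "continuous_map Y X f" "f ` topspace Y = topspace X"
      for Y :: "'b topology" and f
      using that by (rule nw_cz_continuous_image_le)
    show "nw_cz X \<le>o weight X" if "Lindelof_space X"
      using that by (rule nw_cz_le_weight)
    show "nw_cz X =o nw X" if "Lindelof_Sigma_space TYPE('m) TYPE('p) X"
      using le nw_cz_le_nw_Lindelof_Sigma[OF H that] by (simp add: ordIso_iff_ordLeq)
    show "nw_cz X =o natLeq" if "nw X =o natLeq"
      using that by (rule nw_cz_countable)
    fix A :: "'i set" and Xs :: "'i \<Rightarrow> 'c topology" and D
    assume *: "infinite A"
      "\<forall>\<alpha>\<in>A. separable_space (Xs \<alpha>) \<and> metrizable_space (Xs \<alpha>) \<and>
          (\<exists>x\<in>topspace (Xs \<alpha>). \<exists>y\<in>topspace (Xs \<alpha>). x \<noteq> y)"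
      "D \<subseteq> topspace (product_topology Xs A)"
      "product_topology Xs A closure_of D = topspace (product_topology Xs A)"
      "X homeomorphic_space subtopology (product_topology Xs A) D"
    have "nw_cz X \<le>o weight X \<and> weight X =o |A|"
      using *(2) by (intro dense_in_product[OF *(1) _ *(3-5)]) simp
    then show "nw_cz X \<le>o weight X" "weight X =o |A|"
      by simp_all
  qed
qed

end
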